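(* Let $(\mu_1,\mu_2)\in\mathbb{R}^2$ and let $\mathfrak{D}\subset\mathbb{R}^2$ be a simply connected domain with coordinates $(u,v)$. Let $(\omega^i)'=\xi^i\,du$ and $(\omega^i)''=\eta^i\,dv$, $i=0,1,2$, be smooth real $1$-forms on $\mathfrak{D}$ satisfying $$\partial''(\omega^0)'=\mu_1(\omega^1)''\wedge(\omega^1)'+\mu_2(\omega^2)''\wedge(\omega^2)',\qquad \partial''(\omega^i)'=\mu_i(\omega^i)''\wedge(\omega^0)'\quad(i=1,2),$$ $$\partial'(\omega^0)''=\mu_1(\omega^1)'\wedge(\omega^1)''+\mu_2(\omega^2)'\wedge(\omega^2)'',\qquad \partial'(\omega^i)''=\mu_i(\omega^i)'\wedge(\omega^0)''\quad(i=1,2),$$ and $$-(\omega^0)'\otimes(\omega^0)'+(\omega^1)'\otimes(\omega^1)'+(\omega^2)'\otimes(\omega^2)'=0,\qquad -(\omega^0)''\otimes(\omega^0)''+(\omega^1)''\otimes(\omega^1)''+(\omega^2)''\otimes(\omega^2)''=0.$$ Then $$\varphi(u,v)=\int\big((\omega^0)',\,e^{\mu_1x^0}(\omega^1)',\,e^{\mu_2x^0}(\omega^2)'\big)+\int\big((\omega^0)'',\,e^{\mu_1x^0}(\omega^1)'',\,e^{\mu_2x^0}(\omega^2)''\big)$$ is a weakly conformal harmonic map from $\mathfrak{D}$ into $G(\mu_1,\mu_2)$. If in addition $$-(\omega^0)'\otimes(\omega^0)''+(\omega^1)'\otimes(\omega^1)''+(\omega^2)'\otimes(\omega^2)''\neq0$$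 at every point of $\mathfrak{D}$, then $\varphi$ is a minimal timelike surface in $G(\mu_1,\mu_2)$.
   Context: For $(\mu_1,\mu_2)\in\mathbb{R}^2$, $G(\mu_1,\mu_2)$ denotes $\mathbb{R}^3$ with coordinates $(x^0,x^1,x^2)$, the group law $(x^0,x^1,x^2)\cdot(\tilde x^0,\tilde x^1,\tilde x^2)=(x^0+\tilde x^0,\,x^1+e^{\mu_1x^0}\tilde x^1,\,x^2+e^{\mu_2x^0}\tilde x^2)$ and the left-invariant Lorentzian metric $\langle\cdot,\cdot\rangle=-(dx^0)^2+e^{-2\mu_1x^0}(dx^1)^2+e^{-2\mu_2x^0}(dx^2)^2$. Exterior derivative: $d=\partial'+\partial''$, where $\partial'=\frac{\partial}{\partial u}du$ and $\partial''=\frac{\partial}{\partial v}dv$; so $\partial''(\xi\,du)=\xi_v\,dv\wedge du$ and $\partial'(\eta\,dv)=\eta_u\,du\wedge dv$. Meaning of the formula: the integrals are line integrals from a fixed base point of $\mathfrak{D}$ (with arbitrary constants of integration). Thus $\varphi=(x^0,x^1,x^2)$, where first $dx^0=(\omega^0)'+(\omega^0)''$ and then $dx^i=e^{\mu_ix^0}\big((\omega^i)'+(\omega^i)''\big)$ for $i=1,2$; $x^0$ in the formula is the first component of $\varphi$. Null coordinates are related to $(t,x)$ by $u=t+x$, $v=-t+x$. A smooth map $\varphi:\mathfrak{D}\to G(\mu_1,\mu_2)$ is harmonic if it is a critical point, with respect to smooth variations fixing $\varphi$ near the boundary (outside a compact subset, over which the energy is taken), of the energy $E(\varphi)=\int\frac12\big\{-\langle\varphi_t,\varphi_t\rangle+\langle\varphi_x,\varphi_x\rangle\big\}\,dt\,dx$.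 It is weakly conformal if $\langle\varphi_u,\varphi_u\rangle=\langle\varphi_v,\varphi_v\rangle=0$. A timelike surface is an immersion whose induced metric is Lorentzian; it is minimal if its mean curvature vanishes identically. *)

theory Defs
  imports "HOL-Analysis.Analysis"
begin

section \<open>Smooth maps on open sets\<close>

abbreviation dir_deriv ::
    "'a::real_normed_vector \<Rightarrow> ('a \<Rightarrow> 'b::real_normed_vector) \<Rightarrow> 'a \<Rightarrow> 'b"
  where "dir_deriv e f p \<equiv> frechet_derivative f (at p) e"

text \<open>Meant for open \<open>S\<close>, where \<open>differentiable_on\<close> is differentiability at the
  points of \<open>S\<close>; the values of \<open>f\<close> outside \<open>S\<close> are then irrelevant.\<close>

primrec C_k_on ::
    "nat \<Rightarrow> 'a::real_normed_vector set \<Rightarrow> ('a \<Rightarrow> 'b::real_normed_vector) \<Rightarrow> bool"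
where
  "C_k_on 0 S f \<longleftrightarrow> continuous_on S f"
| "C_k_on (Suc k) S f \<longleftrightarrow> f differentiable_on S \<and> (\<forall>e. C_k_on k S (dir_deriv e f))"

definition smooth_on ::
    "'a::real_normed_vector set \<Rightarrow> ('a \<Rightarrow> 'b::real_normed_vector) \<Rightarrow> bool"
  where "smooth_on S f \<longleftrightarrow> (\<forall>k. C_k_on k S f)"

section \<open>Differential forms on the \<open>(u,v)\<close>-plane\<close>

text \<open>The plane is \<open>real \<times> real\<close> with \<open>u = fst\<close> and \<open>v = snd\<close>. A form takes a base point
  and then tangent vectors.\<close>

type_synonym form1 = "real \<times> real \<Rightarrow> real \<times> real \<Rightarrow> real"
type_synonym form2 = "real \<times> real \<Rightarrow> real \<times> real \<Rightarrow> real \<times> real \<Rightarrow> real"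

definition du :: form1 where "du p w = fst w"
definition dv :: form1 where "dv p w = snd w"

definition mult_form :: "(real \<times> real \<Rightarrow> real) \<Rightarrow> form1 \<Rightarrow> form1"
  where "mult_form f \<alpha> = (\<lambda>p w. f p * \<alpha> p w)"

definition wedge :: "form1 \<Rightarrow> form1 \<Rightarrow> form2"
  where "wedge \<alpha> \<beta> = (\<lambda>p a b. \<alpha> p a * \<beta> p b - \<alpha> p b * \<beta> p a)"

definition tensor :: "form1 \<Rightarrow> form1 \<Rightarrow> form2"
  where "tensor \<alpha> \<beta> = (\<lambda>p a b. \<alpha> p a * \<beta> p b)"

text \<open>\<open>del1\<close> and \<open>del2\<close> are the two parts of the exterior derivative,
  \<open>\<partial>' = \<partial>/\<partial>u du\<close> and \<open>\<partial>'' = \<partial>/\<partial>v dv\<close>. The two summands come from writing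
  \<open>\<alpha> = \<alpha>(\<partial>/\<partial>u) du + \<alpha>(\<partial>/\<partial>v) dv\<close>.\<close>

definition del1 :: "form1 \<Rightarrow> form2"
  where "del1 \<alpha> = (\<lambda>p a b.
      dir_deriv (1, 0) (\<lambda>q. \<alpha> q (1, 0)) p * wedge du du p a b
    + dir_deriv (1, 0) (\<lambda>q. \<alpha> q (0, 1)) p * wedge du dv p a b)"

definition del2 :: "form1 \<Rightarrow> form2"
  where "del2 \<alpha> = (\<lambda>p a b.
      dir_deriv (0, 1) (\<lambda>q. \<alpha> q (1, 0)) p * wedge dv du p a b
    + dir_deriv (0, 1) (\<lambda>q. \<alpha> q (0, 1)) p * wedge dv dv p a b)"

lemma del2_mult_du: "del2 (mult_form \<xi> du) p a b = dir_deriv (0, 1) \<xi> p * wedge dv du p a b"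
  by (simp add: del2_def mult_form_def du_def dv_def wedge_def)

lemma del1_mult_dv: "del1 (mult_form \<eta> dv) p a b = dir_deriv (1, 0) \<eta> p * wedge du dv p a b"
  by (simp add: del1_def mult_form_def du_def dv_def wedge_def)

text \<open>\<open>f(p) = c + \<integral> \<alpha>\<close> on \<open>D\<close>, the integral being taken along an arbitrary piecewise
  \<open>C\<^sup>1\<close> path in \<open>D\<close> from the base point \<open>p\<^sub>0\<close> to \<open>p\<close>; path independence is part of the
  assertion.\<close>

definition is_line_integral_of ::
    "(real \<times> real) set \<Rightarrow> real \<times> real \<Rightarrow> real \<Rightarrow> form1 \<Rightarrow> (real \<times> real \<Rightarrow> real) \<Rightarrow> bool"
  where "is_line_integral_of D p\<^sub>0 c \<alpha> f \<longleftrightarrow>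
    (\<forall>p\<in>D. \<forall>\<gamma>. valid_path \<gamma> \<and> path_image \<gamma> \<subseteq> D \<and> pathstart \<gamma> = p\<^sub>0 \<and> pathfinish \<gamma> = p \<longrightarrow>
      ((\<lambda>t. \<alpha> (\<gamma> t) (vector_derivative \<gamma> (at t within {0..1}))) has_integral (f p - c)) {0..1})"

section \<open>The Lorentzian Lie group \<open>G(\<mu>\<^sub>1,\<mu>\<^sub>2)\<close>\<close>

text \<open>The elements of the index type \<open>3\<close> are \<open>0\<close>, \<open>1\<close>, \<open>2\<close> (with \<open>3 = 0\<close>), so the
  coordinates \<open>x\<^sup>0, x\<^sup>1, x\<^sup>2\<close> of a point \<open>x\<close> of \<open>real^3\<close> are \<open>x$0, x$1, x$2\<close>.\<close>

definition vec3 :: "real \<Rightarrow> real \<Rightarrow> real \<Rightarrow> real^3"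
  where "vec3 a b c = (\<chi> i. if i = 0 then a else if i = 1 then b else c)"

lemma vec3_nth [simp]: "vec3 a b c $ 0 = a" "vec3 a b c $ 1 = b" "vec3 a b c $ 2 = c"
  by (simp_all add: vec3_def)

definition G_mult :: "real \<Rightarrow> real \<Rightarrow> real^3 \<Rightarrow> real^3 \<Rightarrow> real^3"
  where "G_mult \<mu>\<^sub>1 \<mu>\<^sub>2 x y =
    vec3 (x$0 + y$0) (x$1 + exp (\<mu>\<^sub>1 * x$0) * y$1) (x$2 + exp (\<mu>\<^sub>2 * x$0) * y$2)"

definition G_metric :: "real \<Rightarrow> real \<Rightarrow> real^3 \<Rightarrow> real^3 \<Rightarrow> real^3 \<Rightarrow> real"
  where "G_metric \<mu>\<^sub>1 \<mu>\<^sub>2 x a b =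
    - (a$0 * b$0) + exp (- 2 * \<mu>\<^sub>1 * x$0) * (a$1 * b$1) + exp (- 2 * \<mu>\<^sub>2 * x$0) * (a$2 * b$2)"

lemma has_derivative_G_mult:
  "(G_mult \<mu>\<^sub>1 \<mu>\<^sub>2 g has_derivative
     (\<lambda>a. vec3 (a$0) (exp (\<mu>\<^sub>1 * g$0) * a$1) (exp (\<mu>\<^sub>2 * g$0) * a$2))) (at x)"
proof -
  let ?L = "\<lambda>a::real^3. vec3 (a$0) (exp (\<mu>\<^sub>1 * g$0) * a$1) (exp (\<mu>\<^sub>2 * g$0) * a$2)"
  have "linear ?L"
    by (rule linearI) (auto simp: vec3_def vec_eq_iff algebra_simps)
  then have "(?L has_derivative ?L) (at x)"
    by (simp add: linear_linear bounded_linear_imp_has_derivative)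
  then have "((\<lambda>a. g + ?L a) has_derivative ?L) (at x)"
    using has_derivative_add [OF has_derivative_const [of g]] by simp
  moreover have "i = 2" if "i \<noteq> 0" "i \<noteq> 1" for i :: 3
    using exhaust_3[of i] that by auto
  then have "G_mult \<mu>\<^sub>1 \<mu>\<^sub>2 g = (\<lambda>a. g + ?L a)"
    by (auto simp: G_mult_def vec3_def vec_eq_iff fun_eq_iff)
  ultimately show ?thesis by simp
qed

lemma G_metric_left_invariant:
  "G_metric \<mu>\<^sub>1 \<mu>\<^sub>2 (G_mult \<mu>\<^sub>1 \<mu>\<^sub>2 g x)
      (frechet_derivative (G_mult \<mu>\<^sub>1 \<mu>\<^sub>2 g) (at x) a)
      (frechet_derivative (G_mult \<mu>\<^sub>1 \<mu>\<^sub>2 g) (at x) b)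
    = G_metric \<mu>\<^sub>1 \<mu>\<^sub>2 x a b"
proof -
  have e: "exp (- 2 * m * (s + r)) * ((exp (m * s) * y) * (exp (m * s) * z))
      = exp (- 2 * m * r) * (y * z)" for m s r y z :: real
  proof -
    have "exp (- 2 * m * (s + r)) * (exp (m * s) * exp (m * s))
        = exp (- 2 * m * (s + r) + (m * s + m * s))"
      by (simp only: exp_add)
    also have "- 2 * m * (s + r) + (m * s + m * s) = - 2 * m * r"
      by (simp add: algebra_simps)
    finally have "exp (- 2 * m * (s + r)) * (exp (m * s) * exp (m * s)) * (y * z)
        = exp (- 2 * m * r) * (y * z)" by (rule arg_cong)
    then show ?thesis by (simp only: mult_ac)
  qed
  show ?thesis
    unfolding frechet_derivative_at [OF has_derivative_G_mult, symmetric] G_metric_def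
    by (simp only: G_mult_def vec3_nth e)
qed

section \<open>Weakly conformal and harmonic maps into \<open>G(\<mu>\<^sub>1,\<mu>\<^sub>2)\<close>\<close>

definition weakly_conformal ::
    "real \<Rightarrow> real \<Rightarrow> (real \<times> real) set \<Rightarrow> (real \<times> real \<Rightarrow> real^3) \<Rightarrow> bool"
  where "weakly_conformal \<mu>\<^sub>1 \<mu>\<^sub>2 D \<phi> \<longleftrightarrow> (\<forall>p\<in>D.
      G_metric \<mu>\<^sub>1 \<mu>\<^sub>2 (\<phi> p) (dir_deriv (1, 0) \<phi> p) (dir_deriv (1, 0) \<phi> p) = 0 \<and>
      G_metric \<mu>\<^sub>1 \<mu>\<^sub>2 (\<phi> p) (dir_deriv (0, 1) \<phi> p) (dir_deriv (0, 1) \<phi> p) = 0)"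

definition uv_of_tx :: "real \<times> real \<Rightarrow> real \<times> real"
  where "uv_of_tx = (\<lambda>(t, x). (t + x, - t + x))"

text \<open>Here \<open>K\<close> and \<open>\<psi>\<close> live in the \<open>(t,x)\<close>-plane.\<close>

definition energy ::
    "real \<Rightarrow> real \<Rightarrow> (real \<times> real) set \<Rightarrow> (real \<times> real \<Rightarrow> real^3) \<Rightarrow> real"
  where "energy \<mu>\<^sub>1 \<mu>\<^sub>2 K \<psi> = (LINT q:K|lborel. 1 / 2 *
      (- G_metric \<mu>\<^sub>1 \<mu>\<^sub>2 (\<psi> q) (dir_deriv (1, 0) \<psi> q) (dir_deriv (1, 0) \<psi> q)
       + G_metric \<mu>\<^sub>1 \<mu>\<^sub>2 (\<psi> q) (dir_deriv (0, 1) \<psi> q) (dir_deriv (0, 1) \<psi> q)))"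

text \<open>\<open>D\<close>, \<open>K\<close> and \<open>\<phi>\<close> are given in the null coordinates \<open>(u,v)\<close>.\<close>

definition harmonic_map ::
    "real \<Rightarrow> real \<Rightarrow> (real \<times> real) set \<Rightarrow> (real \<times> real \<Rightarrow> real^3) \<Rightarrow> bool"
  where "harmonic_map \<mu>\<^sub>1 \<mu>\<^sub>2 D \<phi> \<longleftrightarrow> smooth_on D \<phi> \<and>
    (\<forall>K \<epsilon> \<Phi>. compact K \<and> K \<subseteq> D \<and> 0 < \<epsilon> \<and>
        smooth_on ({-\<epsilon><..<\<epsilon>} \<times> D) (\<Phi> :: real \<times> (real \<times> real) \<Rightarrow> real^3) \<and>
        (\<forall>p\<in>D. \<Phi> (0, p) = \<phi> p) \<and>
        (\<forall>s\<in>{-\<epsilon><..<\<epsilon>}. \<forall>p\<in>D - K. \<Phi> (s, p) = \<phi> p) \<longrightarrow>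
      ((\<lambda>s. energy \<mu>\<^sub>1 \<mu>\<^sub>2 (uv_of_tx -` K) (\<lambda>q. \<Phi> (s, uv_of_tx q)))
        has_real_derivative 0) (at 0))"

section \<open>Timelike minimal surfaces in \<open>G(\<mu>\<^sub>1,\<mu>\<^sub>2)\<close>\<close>

definition induced_metric ::
    "real \<Rightarrow> real \<Rightarrow> (real \<times> real \<Rightarrow> real^3) \<Rightarrow> real \<times> real \<Rightarrow> real \<times> real \<Rightarrow> real \<times> real \<Rightarrow> real"
  where "induced_metric \<mu>\<^sub>1 \<mu>\<^sub>2 \<phi> p a b =
    G_metric \<mu>\<^sub>1 \<mu>\<^sub>2 (\<phi> p) (dir_deriv a \<phi> p) (dir_deriv b \<phi> p)"

text \<open>A symmetric bilinear form on the plane is Lorentzian (signature \<open>(-,+)\<close>) iff it has an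
  orthonormal basis of this type; such \<open>a\<close> and \<open>b\<close> are automatically independent.\<close>

definition lorentzian_form :: "(real \<times> real \<Rightarrow> real \<times> real \<Rightarrow> real) \<Rightarrow> bool"
  where "lorentzian_form B \<longleftrightarrow> (\<exists>a b. B a a = - 1 \<and> B b b = 1 \<and> B a b = 0)"

definition timelike_surface ::
    "real \<Rightarrow> real \<Rightarrow> (real \<times> real) set \<Rightarrow> (real \<times> real \<Rightarrow> real^3) \<Rightarrow> bool"
  where "timelike_surface \<mu>\<^sub>1 \<mu>\<^sub>2 D \<phi> \<longleftrightarrow> smooth_on D \<phi> \<and>
    (\<forall>p\<in>D. inj (frechet_derivative \<phi> (at p))) \<and>
    (\<forall>p\<in>D. lorentzian_form (induced_metric \<mu>\<^sub>1 \<mu>\<^sub>2 \<phi> p))"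

definition G_matrix :: "real \<Rightarrow> real \<Rightarrow> real^3 \<Rightarrow> real^3^3"
  where "G_matrix \<mu>\<^sub>1 \<mu>\<^sub>2 x = (\<chi> i j. G_metric \<mu>\<^sub>1 \<mu>\<^sub>2 x (axis i 1) (axis j 1))"

text \<open>Christoffel symbols \<open>\<Gamma>\<^sup>k\<^sub>i\<^sub>j\<close> of the Levi-Civita connection of \<open>G(\<mu>\<^sub>1,\<mu>\<^sub>2)\<close>.\<close>

definition christoffel :: "real \<Rightarrow> real \<Rightarrow> 3 \<Rightarrow> 3 \<Rightarrow> 3 \<Rightarrow> real^3 \<Rightarrow> real"
  where "christoffel \<mu>\<^sub>1 \<mu>\<^sub>2 k i j x = 1 / 2 * (\<Sum>l\<in>UNIV. matrix_inv (G_matrix \<mu>\<^sub>1 \<mu>\<^sub>2 x) $ k $ l *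
     (dir_deriv (axis i 1) (\<lambda>y. G_matrix \<mu>\<^sub>1 \<mu>\<^sub>2 y $ j $ l) x
    + dir_deriv (axis j 1) (\<lambda>y. G_matrix \<mu>\<^sub>1 \<mu>\<^sub>2 y $ i $ l) x
    - dir_deriv (axis l 1) (\<lambda>y. G_matrix \<mu>\<^sub>1 \<mu>\<^sub>2 y $ i $ j) x))"

text \<open>The coordinate vectors \<open>\<partial>/\<partial>u\<close> (index \<open>1\<close>) and \<open>\<partial>/\<partial>v\<close> (index \<open>2\<close>).\<close>

definition coord_vec :: "2 \<Rightarrow> real \<times> real"
  where "coord_vec a = (if a = 1 then (1, 0) else (0, 1))"

text \<open>The covariant derivative \<open>\<nabla>\<^sub>a (\<partial>\<^sub>b \<phi>)\<close> along \<open>\<phi>\<close>.\<close>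

definition cov_deriv ::
    "real \<Rightarrow> real \<Rightarrow> (real \<times> real \<Rightarrow> real^3) \<Rightarrow> real \<times> real \<Rightarrow> 2 \<Rightarrow> 2 \<Rightarrow> real^3"
  where "cov_deriv \<mu>\<^sub>1 \<mu>\<^sub>2 \<phi> p a b = (\<chi> k.
      dir_deriv (coord_vec a) (dir_deriv (coord_vec b) \<phi>) p $ k
    + (\<Sum>i\<in>UNIV. \<Sum>j\<in>UNIV. christoffel \<mu>\<^sub>1 \<mu>\<^sub>2 k i j (\<phi> p) *
        (dir_deriv (coord_vec a) \<phi> p $ i) * (dir_deriv (coord_vec b) \<phi> p $ j)))"

definition first_fundamental_form ::
    "real \<Rightarrow> real \<Rightarrow> (real \<times> real \<Rightarrow> real^3) \<Rightarrow> real \<times> real \<Rightarrow> real^2^2"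
  where "first_fundamental_form \<mu>\<^sub>1 \<mu>\<^sub>2 \<phi> p =
    (\<chi> a b. induced_metric \<mu>\<^sub>1 \<mu>\<^sub>2 \<phi> p (coord_vec a) (coord_vec b))"

definition normal_part ::
    "real \<Rightarrow> real \<Rightarrow> (real \<times> real \<Rightarrow> real^3) \<Rightarrow> real \<times> real \<Rightarrow> real^3 \<Rightarrow> real^3"
  where "normal_part \<mu>\<^sub>1 \<mu>\<^sub>2 \<phi> p w = w - (\<Sum>a\<in>UNIV. \<Sum>b\<in>UNIV.
      (matrix_inv (first_fundamental_form \<mu>\<^sub>1 \<mu>\<^sub>2 \<phi> p) $ a $ b *
       G_metric \<mu>\<^sub>1 \<mu>\<^sub>2 (\<phi> p) w (dir_deriv (coord_vec a) \<phi> p)) *\<^sub>R dir_deriv (coord_vec b) \<phi> p)"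

definition second_fundamental_form ::
    "real \<Rightarrow> real \<Rightarrow> (real \<times> real \<Rightarrow> real^3) \<Rightarrow> real \<times> real \<Rightarrow> 2 \<Rightarrow> 2 \<Rightarrow> real^3"
  where "second_fundamental_form \<mu>\<^sub>1 \<mu>\<^sub>2 \<phi> p a b =
    normal_part \<mu>\<^sub>1 \<mu>\<^sub>2 \<phi> p (cov_deriv \<mu>\<^sub>1 \<mu>\<^sub>2 \<phi> p a b)"

text \<open>The mean curvature in its normal-vector form: half the trace of the vector-valued second
  fundamental form. It equals \<open>H N\<close> for a unit normal \<open>N\<close> with scalar mean curvature \<open>H\<close>
  (\<open>N\<close> is spacelike for a timelike surface), and so does not depend on the choice of \<open>N\<close>.\<close>

definition mean_curvature_vector ::
    "real \<Rightarrow> real \<Rightarrow> (real \<times> real \<Rightarrow> real^3) \<Rightarrow> real \<times> real \<Rightarrow> real^3"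
  where "mean_curvature_vector \<mu>\<^sub>1 \<mu>\<^sub>2 \<phi> p = (1 / 2) *\<^sub>R (\<Sum>a\<in>UNIV. \<Sum>b\<in>UNIV.
      (matrix_inv (first_fundamental_form \<mu>\<^sub>1 \<mu>\<^sub>2 \<phi> p) $ a $ b) *\<^sub>R
        second_fundamental_form \<mu>\<^sub>1 \<mu>\<^sub>2 \<phi> p a b)"

definition minimal_timelike_surface ::
    "real \<Rightarrow> real \<Rightarrow> (real \<times> real) set \<Rightarrow> (real \<times> real \<Rightarrow> real^3) \<Rightarrow> bool"
  where "minimal_timelike_surface \<mu>\<^sub>1 \<mu>\<^sub>2 D \<phi> \<longleftrightarrow>
    timelike_surface \<mu>\<^sub>1 \<mu>\<^sub>2 D \<phi> \<and> (\<forall>p\<in>D. mean_curvature_vector \<mu>\<^sub>1 \<mu>\<^sub>2 \<phi> p = 0)"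

section \<open>The integral representation\<close>

text \<open>\<open>\<phi> = \<integral> (\<omega>\<^sup>0', e^(\<mu>\<^sub>1 x\<^sup>0) \<omega>\<^sup>1', e^(\<mu>\<^sub>2 x\<^sup>0) \<omega>\<^sup>2') + \<integral> (\<omega>\<^sup>0'', e^(\<mu>\<^sub>1 x\<^sup>0) \<omega>\<^sup>1'', e^(\<mu>\<^sub>2 x\<^sup>0) \<omega>\<^sup>2'')\<close>
  with base point \<open>p\<^sub>0\<close>, constants of integration \<open>c\<close> and \<open>x\<^sup>0\<close> the first component of \<open>\<phi>\<close>.
  Only the sum of the two integrands is closed, so the two integrals share one path.\<close>

definition integral_representation ::
    "real \<Rightarrow> real \<Rightarrow> (real \<times> real) set \<Rightarrow> real \<times> real \<Rightarrow> real^3 \<Rightarrow>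
     (3 \<Rightarrow> form1) \<Rightarrow> (3 \<Rightarrow> form1) \<Rightarrow> (real \<times> real \<Rightarrow> real^3) \<Rightarrow> bool"
  where "integral_representation \<mu>\<^sub>1 \<mu>\<^sub>2 D p\<^sub>0 c \<omega>' \<omega>'' \<phi> \<longleftrightarrow>
    is_line_integral_of D p\<^sub>0 (c$0) (\<lambda>p w. \<omega>' 0 p w + \<omega>'' 0 p w) (\<lambda>p. \<phi> p $ 0) \<and>
    is_line_integral_of D p\<^sub>0 (c$1)
      (\<lambda>p w. exp (\<mu>\<^sub>1 * \<phi> p $ 0) * \<omega>' 1 p w + exp (\<mu>\<^sub>1 * \<phi> p $ 0) * \<omega>'' 1 p w) (\<lambda>p. \<phi> p $ 1) \<and>
    is_line_integral_of D p\<^sub>0 (c$2)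
      (\<lambda>p w. exp (\<mu>\<^sub>2 * \<phi> p $ 0) * \<omega>' 2 p w + exp (\<mu>\<^sub>2 * \<phi> p $ 0) * \<omega>'' 2 p w) (\<lambda>p. \<phi> p $ 2)"

end

theory Submission
  imports Defs "HOL-Complex_Analysis.Riemann_Mapping"
begin

text \<open>Written with \<open>\<omega>\<^sup>i' = \<xi>\<^sub>i du\<close> and \<open>\<omega>\<^sup>i'' = \<eta>\<^sub>i dv\<close>, the structure equations prescribe \<open>\<partial>\<^sub>v \<xi>\<^sub>i\<close> and
  \<open>\<partial>\<^sub>u \<eta>\<^sub>i\<close>. They have two independent meanings. Subtracted, they say that \<open>\<xi>\<^sub>0 du + \<eta>\<^sub>0 dv\<close> is closed and
  that, once its potential \<open>x\<^sup>0\<close> is known, \<open>e^(\<mu>\<^sub>i x\<^sup>0) (\<xi>\<^sub>i du + \<eta>\<^sub>i dv)\<close> is closed as well. Added, they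
  say that the covariant derivative of \<open>\<phi>\<^sub>v\<close> along \<open>\<partial>/\<partial>u\<close> vanishes, which is the equation of a
  harmonic map in null coordinates.

  Existence of \<open>\<phi>\<close>. Closed forms on a simply connected plane domain are exact: the radial
  integral gives a potential on a disc (\<open>poincare_convex\<close>), and the Riemann mapping theorem
  transports it to any simply connected open set (\<open>poincare_simply_connected\<close>). Line integrals of
  exact forms depend only on the end points, so the potentials are line integrals in the required
  sense. Conversely every \<open>\<phi>\<close> with the integral representation agrees on the domain with these
  potentials, so only the differentials of its components matter; the locale \<open>integrated_data\<close>
  records exactly this situation.

  Conformality and minimality. In the left-invariant frame \<open>\<phi>\<^sub>u\<close> and \<open>\<phi>\<^sub>v\<close> have components \<open>\<xi>\<^sub>i\<close> and
  \<open>\<eta>\<^sub>i\<close>, so the null conditions say that the induced metric is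
  \<open>metric_factor \<cdot> (du \<otimes> dv + dv \<otimes> du)\<close>.
  It is Lorentzian where its factor does not vanish. Its inverse has only mixed entries, hence the
  mean curvature is a multiple of the normal part of the mixed covariant derivative, which is zero
  (\<open>cov_deriv_mixed\<close>).

  Harmonicity. The energy density in null coordinates is \<open>2 \<langle>\<Phi>\<^sub>u, \<Phi>\<^sub>v\<rangle>\<close>. For a variation
  \<open>\<Phi> = \<phi> + W\<close>, its part linear in \<open>W\<close> is a divergence \<open>\<partial>\<^sub>u A + \<partial>\<^sub>v B\<close> by the structure
  equations (\<open>linear_variation_divergence\<close>); since \<open>W\<close> vanishes off a compact set, it integrates to
  zero for every parameter value, not only to first order. The remainder is of
  second order in the parameter, and differentiation under the integral sign
  (\<open>derivative_of_integral_zero\<close>) shows that the energy is stationary. Splitting off the linear part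
  before differentiating in the parameter avoids any exchange of second derivatives of \<open>\<Phi>\<close>.\<close>

section \<open>Smooth functions and directional derivatives\<close>

lemma dir_deriv_eq: "(f has_derivative f') (at p) \<Longrightarrow> dir_deriv e f p = f' e"
  by (metis frechet_derivative_at)

text \<open>The values of \<open>f\<close> and \<open>g\<close> outside \<open>S\<close> are arbitrary, so identities of derivatives of functions that are
  specified only on an open set all go through this lemma.\<close>
lemma dir_deriv_cong:
  assumes "open S" "\<And>x. x \<in> S \<Longrightarrow> f x = g x" "p \<in> S"
  shows "dir_deriv e f p = dir_deriv e g p"
proof -
  have "(f has_derivative f') (at p) \<longleftrightarrow> (g has_derivative f') (at p)" for f'
    using has_derivative_transform_within_open[OF _ assms(1,3)] assms(2) by metis
  then show ?thesis by (simp add: frechet_derivative_def)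
qed

lemma differentiable_cong_open:
  assumes "open S" "\<And>x. x \<in> S \<Longrightarrow> f x = g x" "p \<in> S" "f differentiable at p"
  shows "g differentiable at p"
  using assms has_derivative_transform_within_open[OF _ assms(1,3)] unfolding differentiable_def by metis

lemma C_k_on_cong:
  assumes "open S" "\<And>x. x \<in> S \<Longrightarrow> f x = g x" "C_k_on k S f"
  shows "C_k_on k S g"
  using assms(2,3)
proof (induction k arbitrary: f g)
  case 0
  then show ?case using continuous_on_cong[of S S f g] by simp
next
  case (Suc k)
  have "g differentiable_on S"
    using Suc.prems differentiable_cong_open[OF assms(1), of f g]
    by (auto simp: differentiable_on_eq_differentiable_at[OF assms(1)])
  moreover have "C_k_on k S (dir_deriv e g)" for e
    using Suc.prems by (intro Suc.IH[of "dir_deriv e f" "dir_deriv e g"])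
      (auto intro: dir_deriv_cong[OF assms(1)])
  ultimately show ?case by simp
qed

lemma C_k_on_SucD: "C_k_on (Suc k) S f \<Longrightarrow> C_k_on k S f"
proof (induction k arbitrary: f)
  case 0
  then show ?case by (simp add: differentiable_imp_continuous_on)
qed auto

text \<open>The derivative is usually known by a formula \<open>h\<close> valid on \<open>S\<close> only; this form lets the induction on the order of
  differentiability work with that formula.\<close>
lemma C_k_on_SucI:
  assumes "open S" "\<And>p. p \<in> S \<Longrightarrow> f differentiable at p"
    and "\<And>e p. p \<in> S \<Longrightarrow> dir_deriv e f p = h e p" "\<And>e. C_k_on k S (h e)"
  shows "C_k_on (Suc k) S f"
proof -
  have "C_k_on k S (dir_deriv e f)" for e
    using assms(3,4) C_k_on_cong[OF assms(1), of "h e" "dir_deriv e f"] by metis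
  then show ?thesis
    using assms(2) by (simp add: differentiable_on_eq_differentiable_at[OF assms(1)])
qed

lemma C_k_on_differentiable:
  "open S \<Longrightarrow> C_k_on (Suc k) S f \<Longrightarrow> p \<in> S \<Longrightarrow> f differentiable at p"
  by (simp add: differentiable_on_eq_differentiable_at)

lemma smooth_on_differentiable:
  "open S \<Longrightarrow> smooth_on S f \<Longrightarrow> p \<in> S \<Longrightarrow> f differentiable at p"
  unfolding smooth_on_def using C_k_on_differentiable by blast

lemma smooth_on_dir_deriv: "smooth_on S f \<Longrightarrow> smooth_on S (dir_deriv e f)"
  unfolding smooth_on_def by (metis C_k_on.simps(2))

lemma smooth_on_continuous: "smooth_on S f \<Longrightarrow> continuous_on S f"
  unfolding smooth_on_def by (metis C_k_on.simps(1))

lemma dir_deriv_add: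
  assumes "f differentiable at p" "g differentiable at p"
  shows "dir_deriv e (\<lambda>x. f x + g x) p = dir_deriv e f p + dir_deriv e g p"
  using assms by (intro dir_deriv_eq) (auto intro!: derivative_eq_intros simp: frechet_derivative_works)

lemma dir_deriv_diff:
  assumes "f differentiable at p" "g differentiable at p"
  shows "dir_deriv e (\<lambda>x. f x - g x) p = dir_deriv e f p - dir_deriv e g p"
  using assms by (intro dir_deriv_eq) (auto intro!: derivative_eq_intros simp: frechet_derivative_works)

lemma dir_deriv_mult:
  fixes f g :: "'a::real_normed_vector \<Rightarrow> real"
  assumes "f differentiable at p" "g differentiable at p"
  shows "dir_deriv e (\<lambda>x. f x * g x) p = f p * dir_deriv e g p + dir_deriv e f p * g p"
proof -
  have "((\<lambda>x. f x * g x) has_derivative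
      (\<lambda>h. f p * dir_deriv h g p + dir_deriv h f p * g p)) (at p)"
    using assms by (intro has_derivative_mult) (auto simp: frechet_derivative_works)
  then show ?thesis by (rule dir_deriv_eq)
qed

lemma dir_deriv_exp:
  fixes f :: "'a::real_normed_vector \<Rightarrow> real"
  assumes "f differentiable at p"
  shows "dir_deriv e (\<lambda>x. exp (c * f x)) p = c * exp (c * f p) * dir_deriv e f p"
    and "(\<lambda>x. exp (c * f x)) differentiable at p"
proof -
  have *: "((\<lambda>x. exp (c * f x)) has_derivative (\<lambda>h. c * exp (c * f p) * dir_deriv h f p)) (at p)"
    using assms[unfolded frechet_derivative_works]
    by (auto intro!: derivative_eq_intros simp: fun_eq_iff)
  then show "dir_deriv e (\<lambda>x. exp (c * f x)) p = c * exp (c * f p) * dir_deriv e f p"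
    by (rule dir_deriv_eq)
  show "(\<lambda>x. exp (c * f x)) differentiable at p"
    using * by (rule differentiableI)
qed

lemma dir_deriv_bounded_linear:
  assumes "bounded_linear L" "f differentiable at p"
  shows "dir_deriv e (\<lambda>x. L (f x)) p = L (dir_deriv e f p)"
  using bounded_linear.has_derivative[OF assms(1)] assms(2)
  by (intro dir_deriv_eq) (auto simp: frechet_derivative_works)

lemma dir_deriv_plane:
  fixes f :: "real \<times> real \<Rightarrow> real"
  assumes "f differentiable at p"
  shows "dir_deriv w f p = dir_deriv (1, 0) f p * fst w + dir_deriv (0, 1) f p * snd w"
proof -
  from assms have "(f has_derivative frechet_derivative f (at p)) (at p)"
    using frechet_derivative_works by blast
  then interpret bounded_linear "frechet_derivative f (at p)" by (rule has_derivative_bounded_linear)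
  have "dir_deriv (fst w *\<^sub>R (1, 0) + snd w *\<^sub>R (0, 1)) f p
      = dir_deriv (1, 0) f p * fst w + dir_deriv (0, 1) f p * snd w"
    by (simp only: add scaleR) simp
  then show ?thesis by simp
qed

lemma C_k_on_const: "C_k_on k S (\<lambda>x. c)"
proof (induction k arbitrary: c)
  case (Suc k)
  have "dir_deriv e (\<lambda>x. c) = (\<lambda>x. 0)" for e :: 'a by (auto simp: frechet_derivative_const)
  then show ?case using Suc by simp
qed simp

lemma C_k_on_add:
  assumes "open S"
  shows "C_k_on k S f \<Longrightarrow> C_k_on k S g \<Longrightarrow> C_k_on k S (\<lambda>x. f x + g x)"
proof (induction k arbitrary: f g)
  case 0
  then show ?case by (auto intro: continuous_intros)
next
  case (Suc k)
  note d = C_k_on_differentiable[OF assms Suc.prems(1)] C_k_on_differentiable[OF assms Suc.prems(2)]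
  show ?case
    by (rule C_k_on_SucI[OF assms, where h = "\<lambda>e p. dir_deriv e f p + dir_deriv e g p"])
      (use Suc in \<open>auto simp: d dir_deriv_add\<close>)
qed

lemma C_k_on_mult:
  fixes f g :: "'a::real_normed_vector \<Rightarrow> real"
  assumes "open S"
  shows "C_k_on k S f \<Longrightarrow> C_k_on k S g \<Longrightarrow> C_k_on k S (\<lambda>x. f x * g x)"
proof (induction k arbitrary: f g)
  case 0
  then show ?case by (auto intro: continuous_intros)
next
  case (Suc k)
  note d = C_k_on_differentiable[OF assms Suc.prems(1)] C_k_on_differentiable[OF assms Suc.prems(2)]
  show ?case
  proof (rule C_k_on_SucI[OF assms,
        where h = "\<lambda>e p. f p * dir_deriv e g p + dir_deriv e f p * g p"])
    show "C_k_on k S (\<lambda>p. f p * dir_deriv e g p + dir_deriv e f p * g p)" for e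
      using Suc.prems Suc.prems[THEN C_k_on_SucD]
      by (intro C_k_on_add[OF assms] Suc.IH) auto
  qed (auto simp: d dir_deriv_mult)
qed

lemma C_k_on_exp:
  fixes f :: "'a::real_normed_vector \<Rightarrow> real"
  assumes "open S"
  shows "C_k_on k S f \<Longrightarrow> C_k_on k S (\<lambda>x. exp (c * f x))"
proof (induction k)
  case 0
  then show ?case by (auto intro!: continuous_intros)
next
  case (Suc k)
  note d = C_k_on_differentiable[OF assms Suc.prems]
  show ?case
  proof (rule C_k_on_SucI[OF assms, where h = "\<lambda>e p. c * exp (c * f p) * dir_deriv e f p"])
    show "C_k_on k S (\<lambda>p. c * exp (c * f p) * dir_deriv e f p)" for e
      using Suc.prems Suc.IH[OF C_k_on_SucD[OF Suc.prems]]
      by (intro C_k_on_mult[OF assms] C_k_on_const) auto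
  qed (auto simp: d dir_deriv_exp)
qed

lemma C_k_on_bounded_linear:
  assumes "open S" "bounded_linear L"
  shows "C_k_on k S f \<Longrightarrow> C_k_on k S (\<lambda>x. L (f x))"
proof (induction k arbitrary: f)
  case 0
  then show ?case using bounded_linear.continuous_on[OF assms(2)] by auto
next
  case (Suc k)
  note d = C_k_on_differentiable[OF assms(1) Suc.prems]
  show ?case
  proof (rule C_k_on_SucI[OF assms(1), where h = "\<lambda>e p. L (dir_deriv e f p)"])
    show "C_k_on k S (\<lambda>p. L (dir_deriv e f p))" for e
      using Suc.IH[of "dir_deriv e f"] Suc.prems by auto
    show "dir_deriv e (\<lambda>x. L (f x)) p = L (dir_deriv e f p)" if "p \<in> S" for e p
      using dir_deriv_bounded_linear[OF assms(2) d[OF that]] .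
  next
    fix p assume "p \<in> S"
    from d[OF this] show "(\<lambda>x. L (f x)) differentiable at p"
      using bounded_linear.has_derivative[OF assms(2)] unfolding differentiable_def by blast
  qed
qed

lemma dir_deriv_affine:
  assumes "bounded_linear L" "f differentiable at (a + L x)"
  shows "dir_deriv e (\<lambda>x. f (a + L x)) x = dir_deriv (L e) f (a + L x)"
    and "(\<lambda>x. f (a + L x)) differentiable at x"
proof -
  have "((\<lambda>x. a + L x) has_derivative L) (at x)"
    using assms(1) by (auto intro!: derivative_eq_intros bounded_linear_imp_has_derivative)
  from has_derivative_compose[OF this assms(2)[unfolded frechet_derivative_works]]
  have *: "((\<lambda>x. f (a + L x)) has_derivative (\<lambda>e. dir_deriv (L e) f (a + L x))) (at x)" .
  show "dir_deriv e (\<lambda>x. f (a + L x)) x = dir_deriv (L e) f (a + L x)"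
    using * by (rule dir_deriv_eq)
  show "(\<lambda>x. f (a + L x)) differentiable at x"
    using * by (rule differentiableI)
qed

text \<open>Affine substitutions cover both uses below: restricting a variation to a fixed parameter value and
  pulling a function on the domain back to the space of parameters and points.\<close>
lemma C_k_on_affine:
  assumes "open S" "open T" "bounded_linear L" "\<And>x. x \<in> T \<Longrightarrow> a + L x \<in> S"
  shows "C_k_on k S f \<Longrightarrow> C_k_on k T (\<lambda>x. f (a + L x))"
proof (induction k arbitrary: f)
  case 0
  have "continuous_on T (\<lambda>x. a + L x)"
    by (intro continuous_intros linear_continuous_on assms(3))
  with 0 show ?case using assms(4) by (auto intro: continuous_on_compose2[of S f])
next
  case (Suc k)
  note d = C_k_on_differentiable[OF assms(1) Suc.prems assms(4)]
  show ?case
  proof (rule C_k_on_SucI[OF assms(2), where h = "\<lambda>e p. dir_deriv (L e) f (a + L p)"])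
    show "C_k_on k T (\<lambda>p. dir_deriv (L e) f (a + L p))" for e
      using Suc.IH[of "dir_deriv (L e) f"] Suc.prems by auto
  qed (auto simp: dir_deriv_affine[OF assms(3) d])
qed

lemma smooth_on_const: "smooth_on S (\<lambda>x. c)"
  unfolding smooth_on_def using C_k_on_const by blast

lemma smooth_on_add:
  "open S \<Longrightarrow> smooth_on S f \<Longrightarrow> smooth_on S g \<Longrightarrow> smooth_on S (\<lambda>x. f x + g x)"
  unfolding smooth_on_def using C_k_on_add by blast

lemma smooth_on_mult:
  fixes f g :: "'a::real_normed_vector \<Rightarrow> real"
  shows "open S \<Longrightarrow> smooth_on S f \<Longrightarrow> smooth_on S g \<Longrightarrow> smooth_on S (\<lambda>x. f x * g x)"
  unfolding smooth_on_def using C_k_on_mult by blast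

lemma smooth_on_minus:
  fixes f :: "'a::real_normed_vector \<Rightarrow> 'b::real_normed_vector"
  shows "open S \<Longrightarrow> smooth_on S f \<Longrightarrow> smooth_on S (\<lambda>x. - f x)"
  unfolding smooth_on_def
  using C_k_on_bounded_linear[OF _ bounded_linear_minus[OF bounded_linear_ident]] by blast

lemma smooth_on_diff:
  "open S \<Longrightarrow> smooth_on S f \<Longrightarrow> smooth_on S g \<Longrightarrow> smooth_on S (\<lambda>x. f x - g x)"
  using smooth_on_add[OF _ _ smooth_on_minus, of S f g] by simp

lemma smooth_on_exp:
  fixes f :: "'a::real_normed_vector \<Rightarrow> real"
  shows "open S \<Longrightarrow> smooth_on S f \<Longrightarrow> smooth_on S (\<lambda>x. exp (c * f x))"
  unfolding smooth_on_def using C_k_on_exp by blast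

lemma smooth_on_bounded_linear:
  "bounded_linear L \<Longrightarrow> open S \<Longrightarrow> smooth_on S f \<Longrightarrow> smooth_on S (\<lambda>x. L (f x))"
  unfolding smooth_on_def using C_k_on_bounded_linear by blast

lemma smooth_on_slice:
  fixes f :: "'a::real_normed_vector \<times> 'b::real_normed_vector \<Rightarrow> 'c::real_normed_vector"
  assumes "open I" "open S" "smooth_on (I \<times> S) f" "s \<in> I"
  shows "smooth_on S (\<lambda>p. f (s, p))"
proof -
  have bl: "bounded_linear (\<lambda>p::'b. (0::'a, p))"
    by (intro bounded_linear_Pair bounded_linear_zero bounded_linear_ident)
  have "C_k_on k S (\<lambda>p. f ((s, 0) + (0, p)))" for k
    using assms
    by (intro C_k_on_affine[OF open_Times[OF assms(1,2)] assms(2) bl]) (auto simp: smooth_on_def)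
  then show ?thesis by (simp add: smooth_on_def)
qed

lemma dir_deriv_slice:
  fixes f :: "'a::real_normed_vector \<times> 'b::real_normed_vector \<Rightarrow> 'c::real_normed_vector"
  assumes "f differentiable at (s, p)"
  shows "dir_deriv e (\<lambda>p. f (s, p)) p = dir_deriv (0, e) f (s, p)"
proof -
  have bl: "bounded_linear (\<lambda>p::'b. (0::'a, p))"
    by (intro bounded_linear_Pair bounded_linear_zero bounded_linear_ident)
  show ?thesis using dir_deriv_affine(1)[OF bl, of f "(s, 0)" p e] assms by simp
qed

lemma smooth_on_snd:
  assumes "open I" "open S" "smooth_on S f"
  shows "smooth_on (I \<times> S) (\<lambda>z. f (snd z))"
  using assms(3) C_k_on_affine[OF assms(2) open_Times[OF assms(1,2)] bounded_linear_snd, of 0 _ f]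
  by (auto simp: smooth_on_def)

text \<open>A potential is one order smoother than its form. This yields the smoothness of \<open>\<phi>\<close> without any
  simultaneous induction over its components.\<close>
lemma smooth_on_gradient:
  fixes F P Q :: "real \<times> real \<Rightarrow> real"
  assumes S: "open S"
    and F: "\<And>p. p \<in> S \<Longrightarrow> (F has_derivative (\<lambda>w. P p * fst w + Q p * snd w)) (at p)"
    and "smooth_on S P" "smooth_on S Q"
  shows "smooth_on S F"
proof -
  have "C_k_on (Suc k) S F" for k
  proof (rule C_k_on_SucI[OF S, where h = "\<lambda>e p. P p * fst e + Q p * snd e"])
    show "C_k_on k S (\<lambda>p. P p * fst e + Q p * snd e)" for e
      using assms(3,4) by (intro C_k_on_add C_k_on_mult C_k_on_const S) (auto simp: smooth_on_def)
  qed (use F differentiableI in \<open>blast, simp add: dir_deriv_eq[OF F]\<close>)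
  then show ?thesis unfolding smooth_on_def using C_k_on_SucD by blast
qed

lemma vec3_linear_combination: "vec3 a b c = a *\<^sub>R vec3 1 0 0 + b *\<^sub>R vec3 0 1 0 + c *\<^sub>R vec3 0 0 1"
  by (simp add: vec3_def vec_eq_iff)

lemma vec3_eta: "vec3 (x $ 0) (x $ 1) (x $ 2) = x"
proof -
  have "i = 2" if "i \<noteq> 0" "i \<noteq> 1" for i :: 3
    using exhaust_3[of i] that by auto
  then show ?thesis by (auto simp: vec_eq_iff vec3_def)
qed

lemma has_derivative_vec3:
  assumes "(a has_derivative a') F" "(b has_derivative b') F" "(c has_derivative c') F"
  shows "((\<lambda>p. vec3 (a p) (b p) (c p)) has_derivative (\<lambda>w. vec3 (a' w) (b' w) (c' w))) F"
  unfolding vec3_linear_combination[of "_ _"]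
  by (intro has_derivative_add has_derivative_scaleR_left assms)

lemma smooth_on_vec3:
  assumes "open S" "smooth_on S a" "smooth_on S b" "smooth_on S c"
  shows "smooth_on S (\<lambda>p. vec3 (a p) (b p) (c p))"
  unfolding vec3_linear_combination[of "_ _"]
  by (intro smooth_on_add smooth_on_bounded_linear[OF bounded_linear_scaleR_left] assms)

section \<open>Closed forms on simply connected planar domains\<close>

text \<open>The potential is the radial integral \<open>F(x) = \<integral>\<^sub>0\<^sup>1 P(tx) x\<^sub>1 + Q(tx) x\<^sub>2 dt\<close>. By closedness the
  coefficient of \<open>du\<close> in its differential is the integral of \<open>d/dt (t P(tx))\<close>, and likewise for
  \<open>dv\<close> with \<open>Q\<close>, so the differential is \<open>P du + Q dv\<close>.\<close>
lemma poincare_convex: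
  fixes P Q Pu Pv Qu Qv :: "real \<times> real \<Rightarrow> real"
  assumes S: "open S" "convex S" "0 \<in> S"
    and P: "\<And>p. p \<in> S \<Longrightarrow> (P has_derivative (\<lambda>w. Pu p * fst w + Pv p * snd w)) (at p)"
    and Q: "\<And>p. p \<in> S \<Longrightarrow> (Q has_derivative (\<lambda>w. Qu p * fst w + Qv p * snd w)) (at p)"
    and cont: "continuous_on S Pu" "continuous_on S Pv" "continuous_on S Qu" "continuous_on S Qv"
    and closed: "\<And>p. p \<in> S \<Longrightarrow> Pv p = Qu p"
  shows "\<exists>F. \<forall>p\<in>S. (F has_derivative (\<lambda>w. P p * fst w + Q p * snd w)) (at p)"
proof -
  define f where "f = (\<lambda>x t. P (t *\<^sub>R x) * fst x + Q (t *\<^sub>R x) * snd x)"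
  define fx :: "real \<times> real \<Rightarrow> real \<Rightarrow> (real \<times> real) \<Rightarrow>\<^sub>L real" where
    "fx = (\<lambda>x t.
      (t * (Pu (t *\<^sub>R x) * fst x + Qu (t *\<^sub>R x) * snd x) + P (t *\<^sub>R x)) *\<^sub>R fst_blinfun
      + (t * (Pv (t *\<^sub>R x) * fst x + Qv (t *\<^sub>R x) * snd x) + Q (t *\<^sub>R x)) *\<^sub>R snd_blinfun)"
  have seg: "t *\<^sub>R x \<in> S" if "x \<in> S" "t \<in> {0..1}" for x t
    using convexD[OF S(2,3) that(1), of "1 - t" t] that(2) by simp
  have contP: "continuous_on S P" and contQ: "continuous_on S Q"
    using P Q by (meson continuous_at_imp_continuous_on has_derivative_continuous)+
  have contseg: "continuous_on (S \<times> {0..1}) (\<lambda>z. h (snd z *\<^sub>R fst z))"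
    if "continuous_on S h" for h :: "real \<times> real \<Rightarrow> real"
    by (rule continuous_on_compose2[OF that])
      (auto intro!: continuous_intros seg simp del: scaleR_Pair)
  have contseg1: "continuous_on {0..1} (\<lambda>t. h (t *\<^sub>R x))"
    if "continuous_on S h" "x \<in> S" for h :: "real \<times> real \<Rightarrow> real" and x
    by (rule continuous_on_compose2[OF that(1)]) (auto intro!: continuous_intros seg that(2))
  have "((\<lambda>x. integral (cbox 0 1) (f x)) has_derivative (\<lambda>w. P p * fst w + Q p * snd w)) (at p)"
    if p: "p \<in> S" for p
  proof -
    have "((\<lambda>x. integral (cbox 0 1) (f x)) has_derivative integral (cbox 0 1) (fx p))
        (at p within S)"
    proof (rule leibniz_rule)
      fix x and t :: real assume x: "x \<in> S" and "t \<in> cbox 0 1"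
      then have tx: "t *\<^sub>R x \<in> S" using seg by simp
      have sc: "((\<lambda>x. t *\<^sub>R x) has_derivative (\<lambda>w. t *\<^sub>R w)) (at x)"
        by (auto intro!: derivative_eq_intros)
      have 1: "((\<lambda>x. P (t *\<^sub>R x)) has_derivative
          (\<lambda>w. Pu (t *\<^sub>R x) * fst (t *\<^sub>R w) + Pv (t *\<^sub>R x) * snd (t *\<^sub>R w))) (at x)"
        by (rule has_derivative_compose[OF sc P[OF tx]])
      have 2: "((\<lambda>x. Q (t *\<^sub>R x)) has_derivative
          (\<lambda>w. Qu (t *\<^sub>R x) * fst (t *\<^sub>R w) + Qv (t *\<^sub>R x) * snd (t *\<^sub>R w))) (at x)"
        by (rule has_derivative_compose[OF sc Q[OF tx]])
      have "((\<lambda>x. f x t) has_derivative blinfun_apply (fx x t)) (at x)"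
        unfolding f_def
        by (rule has_derivative_eq_rhs[OF has_derivative_add[OF
              has_derivative_mult[OF 1 has_derivative_fst[OF has_derivative_ident]]
              has_derivative_mult[OF 2 has_derivative_snd[OF has_derivative_ident]]]])
          (auto simp: fun_eq_iff fx_def blinfun.add_left blinfun.scaleR_left algebra_simps)
      then show "((\<lambda>x. f x t) has_derivative blinfun_apply (fx x t)) (at x within S)"
        by (rule has_derivative_at_withinI)
    next
      fix x assume "x \<in> S"
      then show "f x integrable_on cbox 0 1" unfolding f_def
        by (intro integrable_continuous continuous_intros) (auto intro!: contseg1 contP contQ)
    next
      show "continuous_on (S \<times> cbox 0 1) (\<lambda>(x, t). fx x t)"
        unfolding fx_def split_beta cbox_interval
        by (intro continuous_intros contseg cont contP contQ)
    qed (use p S in auto)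
    moreover have "(fx p has_integral P p *\<^sub>R fst_blinfun + Q p *\<^sub>R snd_blinfun) (cbox 0 1)"
    proof -
      have D: "((\<lambda>t. t * h (t *\<^sub>R p)) has_vector_derivative
          t * (a (t *\<^sub>R p) * fst p + b (t *\<^sub>R p) * snd p) + h (t *\<^sub>R p)) (at t within {0..1})"
        if h: "\<And>q. q \<in> S \<Longrightarrow> (h has_derivative (\<lambda>w. a q * fst w + b q * snd w)) (at q)"
          and t: "t \<in> {0..1}" for h a b :: "real \<times> real \<Rightarrow> real" and t
      proof -
        have "((\<lambda>t. t *\<^sub>R p) has_derivative (\<lambda>s. s *\<^sub>R p)) (at t within {0..1})"
          by (auto intro!: derivative_eq_intros)
        from has_derivative_compose[OF this h[OF seg[OF p t]]]
        have "((\<lambda>t. h (t *\<^sub>R p)) has_derivative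
            (\<lambda>s. a (t *\<^sub>R p) * fst (s *\<^sub>R p) + b (t *\<^sub>R p) * snd (s *\<^sub>R p))) (at t within {0..1})" .
        from has_derivative_mult[OF has_derivative_ident this]
        show ?thesis unfolding has_vector_derivative_def
          by (rule has_derivative_eq_rhs) (auto simp: fun_eq_iff algebra_simps)
      qed
      have "((\<lambda>t. t * (Pu (t *\<^sub>R p) * fst p + Pv (t *\<^sub>R p) * snd p) + P (t *\<^sub>R p))
          has_integral 1 * P (1 *\<^sub>R p) - 0 * P (0 *\<^sub>R p)) {0..1}"
        by (rule fundamental_theorem_of_calculus) (use D[OF P] in auto)
      then have 1: "((\<lambda>t. t * (Pu (t *\<^sub>R p) * fst p + Qu (t *\<^sub>R p) * snd p) + P (t *\<^sub>R p))
          has_integral P p) (cbox 0 1)"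
        unfolding cbox_interval
        by (auto intro: has_integral_eq[rotated] simp: closed seg[OF p])
      have "((\<lambda>t. t * (Qu (t *\<^sub>R p) * fst p + Qv (t *\<^sub>R p) * snd p) + Q (t *\<^sub>R p))
          has_integral 1 * Q (1 *\<^sub>R p) - 0 * Q (0 *\<^sub>R p)) {0..1}"
        by (rule fundamental_theorem_of_calculus) (use D[OF Q] in auto)
      then have 2: "((\<lambda>t. t * (Pv (t *\<^sub>R p) * fst p + Qv (t *\<^sub>R p) * snd p) + Q (t *\<^sub>R p))
          has_integral Q p) (cbox 0 1)"
        unfolding cbox_interval
        by (auto intro: has_integral_eq[rotated] simp: closed seg[OF p])
      show ?thesis unfolding fx_def
        by (rule has_integral_add[OF has_integral_scaleR_left[OF 1] has_integral_scaleR_left[OF 2]])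
    qed
    ultimately have "((\<lambda>x. integral (cbox 0 1) (f x)) has_derivative
        blinfun_apply (P p *\<^sub>R fst_blinfun + Q p *\<^sub>R snd_blinfun)) (at p within S)"
      by (simp add: integral_unique)
    moreover have "blinfun_apply (P p *\<^sub>R fst_blinfun + Q p *\<^sub>R snd_blinfun)
        = (\<lambda>w. P p * fst w + Q p * snd w)"
      by (auto simp: blinfun.add_left blinfun.scaleR_left)
    ultimately show ?thesis
      using at_within_open[OF p S(1)] by simp
  qed
  then show ?thesis by blast
qed

text \<open>The Cauchy-Riemann equations for a holomorphic map in real coordinates.\<close>
lemma holomorphic_coord_derivative:
  assumes "(g has_field_derivative d) (at (Complex (fst p) (snd p)))"
  shows "((\<lambda>q. Re (g (Complex (fst q) (snd q)))) has_derivative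
      (\<lambda>w. Re d * fst w + - Im d * snd w)) (at p)"
    and "((\<lambda>q. Im (g (Complex (fst q) (snd q)))) has_derivative
      (\<lambda>w. Im d * fst w + Re d * snd w)) (at p)"
proof -
  have z: "((\<lambda>q. Complex (fst q) (snd q)) has_derivative (\<lambda>w. Complex (fst w) (snd w))) (at p)"
    unfolding Complex_eq by (auto intro!: derivative_eq_intros)
  have g: "((\<lambda>q. g (Complex (fst q) (snd q))) has_derivative
      (\<lambda>w. d * Complex (fst w) (snd w))) (at p)"
    using has_derivative_compose[OF z] assms by (simp add: has_field_derivative_def)
  show "((\<lambda>q. Re (g (Complex (fst q) (snd q)))) has_derivative
      (\<lambda>w. Re d * fst w + - Im d * snd w)) (at p)"
    using has_derivative_Re[OF g] by simp
  show "((\<lambda>q. Im (g (Complex (fst q) (snd q)))) has_derivative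
      (\<lambda>w. Im d * fst w + Re d * snd w)) (at p)"
    using has_derivative_Im[OF g] by (simp add: add.commute)
qed

text \<open>The domain is the whole plane or there is a biholomorphic map \<open>g\<close> from the unit disc onto it, with inverse \<open>f\<close>. The
  pullback of the form by \<open>g\<close> is closed, because the mixed second derivatives of \<open>g\<close> are equal by the
  Cauchy-Riemann equations for \<open>g'\<close>. Its potential on the disc, composed with \<open>f\<close>, is a potential
  of the given form because \<open>g' f' = 1\<close>.\<close>
lemma poincare_simply_connected:
  fixes P Q Pu Pv Qu Qv :: "real \<times> real \<Rightarrow> real"
  assumes S: "open S" "simply_connected S"
    and P: "\<And>p. p \<in> S \<Longrightarrow> (P has_derivative (\<lambda>w. Pu p * fst w + Pv p * snd w)) (at p)"
    and Q: "\<And>p. p \<in> S \<Longrightarrow> (Q has_derivative (\<lambda>w. Qu p * fst w + Qv p * snd w)) (at p)"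
    and cont: "continuous_on S Pu" "continuous_on S Pv" "continuous_on S Qu" "continuous_on S Qv"
    and closed: "\<And>p. p \<in> S \<Longrightarrow> Pv p = Qu p"
  shows "\<exists>F. \<forall>p\<in>S. (F has_derivative (\<lambda>w. P p * fst w + Q p * snd w)) (at p)"
proof -
  define z where "z = (\<lambda>q. Complex (fst q) (snd q))"
  define r where "r = (\<lambda>w. (Re w, Im w))"
  have rz [simp]: "r (z q) = q" "z (r w) = w" for q w by (auto simp: z_def r_def)
  have contz: "continuous_on A z" for A
    unfolding z_def Complex_eq by (intro continuous_intros)
  have contr: "continuous_on A r" for A
    unfolding r_def by (intro continuous_intros)
  define T where "T = r -` S"
  have "homeomorphism S T z r"
    by (rule homeomorphismI) (auto simp: contz contr T_def)
  then have "simply_connected T"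
    using S(2) homeomorphic_simply_connected homeomorphic_def by blast
  moreover have oT: "open T"
    unfolding T_def by (rule open_vimage[OF S(1) contr])
  ultimately consider "T = {}" | "T = UNIV" | f g where
      "f holomorphic_on T" "g holomorphic_on ball 0 1"
      "\<And>w. w \<in> T \<Longrightarrow> f w \<in> ball 0 1" "\<And>w. w \<in> T \<Longrightarrow> g (f w) = w"
      "\<And>w. w \<in> ball 0 1 \<Longrightarrow> g w \<in> T" "\<And>w. w \<in> ball 0 1 \<Longrightarrow> f (g w) = w"
    using simply_connected_eq_biholomorphic_to_disc[OF oT] by metis
  then show ?thesis
  proof cases
    case 1
    then have "S = {}" unfolding T_def using rz(1) by blast
    then show ?thesis by simp
  next
    case 2
    then have "S = UNIV" unfolding T_def by (metis UNIV_I UNIV_eq_I rz(1) vimageD)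
    then show ?thesis using poincare_convex[OF S(1) _ _ P Q cont closed] by auto
  next
    case 3
    note fg = this
    let ?B = "ball 0 1 :: (real \<times> real) set"
    have zB: "z q \<in> ball 0 1" if "q \<in> ?B" for q
      using that by (cases q) (auto simp: z_def cmod_def norm_Pair)
    have rB: "r w \<in> ?B" if "w \<in> ball 0 1" for w
      using that by (auto simp: r_def cmod_def norm_Pair)
    \<comment> \<open>\<open>G\<close> is \<open>g\<close> in real coordinates; its Jacobian matrix has rows \<open>(\<alpha>, -\<beta>)\<close> and \<open>(\<beta>, \<alpha>)\<close>,
    and the pulled back form is \<open>(P \<alpha> + Q \<beta>) du + (- P \<beta> + Q \<alpha>) dv\<close>.\<close>
    define G where "G = (\<lambda>q. r (g (z q)))"
    define \<alpha> where "\<alpha> = (\<lambda>q. Re (deriv g (z q)))"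
    define \<beta> where "\<beta> = (\<lambda>q. Im (deriv g (z q)))"
    define \<alpha>' where "\<alpha>' = (\<lambda>q. Re (deriv (deriv g) (z q)))"
    define \<beta>' where "\<beta>' = (\<lambda>q. Im (deriv (deriv g) (z q)))"
    have hg': "deriv g holomorphic_on ball 0 1" and hg'': "deriv (deriv g) holomorphic_on ball 0 1"
      using fg(2) by (auto intro!: holomorphic_deriv)
    have GS: "G q \<in> S" if "q \<in> ?B" for q
      using fg(5)[OF zB[OF that]] by (simp add: G_def T_def)
    have Gfst: "((\<lambda>q. fst (G q)) has_derivative (\<lambda>w. \<alpha> q * fst w + - \<beta> q * snd w)) (at q)"
      and Gsnd: "((\<lambda>q. snd (G q)) has_derivative (\<lambda>w. \<beta> q * fst w + \<alpha> q * snd w)) (at q)"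
      if "q \<in> ?B" for q
      using holomorphic_coord_derivative[OF holomorphic_derivI[OF fg(2) open_ball zB[OF that],
            unfolded z_def]]
      by (simp_all add: G_def r_def \<alpha>_def \<beta>_def z_def)
    have GD: "(G has_derivative
        (\<lambda>w. (\<alpha> q * fst w + - \<beta> q * snd w, \<beta> q * fst w + \<alpha> q * snd w))) (at q)"
      if "q \<in> ?B" for q
      using has_derivative_Pair[OF Gfst[OF that] Gsnd[OF that]] by simp
    have \<alpha>D: "(\<alpha> has_derivative (\<lambda>w. \<alpha>' q * fst w + - \<beta>' q * snd w)) (at q)"
      and \<beta>D: "(\<beta> has_derivative (\<lambda>w. \<beta>' q * fst w + \<alpha>' q * snd w)) (at q)"
      if "q \<in> ?B" for q
      using holomorphic_coord_derivative[OF holomorphic_derivI[OF hg' open_ball zB[OF that],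
            unfolded z_def]]
      by (simp_all add: \<alpha>_def \<beta>_def \<alpha>'_def \<beta>'_def z_def)
    have chain: "((\<lambda>q. h (G q)) has_derivative
          (\<lambda>w. (a (G q) * \<alpha> q + b (G q) * \<beta> q) * fst w
             + (- a (G q) * \<beta> q + b (G q) * \<alpha> q) * snd w)) (at q)"
      if h: "\<And>p. p \<in> S \<Longrightarrow> (h has_derivative (\<lambda>w. a p * fst w + b p * snd w)) (at p)"
        and q: "q \<in> ?B" for h :: "real \<times> real \<Rightarrow> real" and a b q
      by (rule has_derivative_eq_rhs[OF has_derivative_compose[OF GD[OF q] h[OF GS[OF q]]]])
        (auto simp: algebra_simps)
    have contB: "continuous_on ?B (\<lambda>q. h (z q))"
      if "h holomorphic_on ball 0 1" for h :: "complex \<Rightarrow> complex"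
      by (rule continuous_on_compose2[OF holomorphic_on_imp_continuous_on[OF that] contz])
        (use zB in auto)
    have contG: "continuous_on ?B G"
      using GD by (meson continuous_at_imp_continuous_on has_derivative_continuous)
    have contBG: "continuous_on ?B (\<lambda>q. h (G q))" if "continuous_on S h" for h :: "real \<times> real \<Rightarrow> real"
      by (rule continuous_on_compose2[OF that contG]) (use GS in auto)
    have cont\<alpha>: "continuous_on ?B \<alpha>" "continuous_on ?B \<beta>" "continuous_on ?B \<alpha>'" "continuous_on ?B \<beta>'"
      unfolding \<alpha>_def \<beta>_def \<alpha>'_def \<beta>'_def by (intro continuous_intros contB hg' hg'')+
    have contP: "continuous_on S P" and contQ: "continuous_on S Q"
      using P Q by (meson continuous_at_imp_continuous_on has_derivative_continuous)+
    have "\<exists>F. \<forall>q\<in>?B. (F has_derivative (\<lambda>w. (P (G q) * \<alpha> q + Q (G q) * \<beta> q) * fst w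
        + (- P (G q) * \<beta> q + Q (G q) * \<alpha> q) * snd w)) (at q)"
    proof (rule poincare_convex)
      fix q assume q: "q \<in> ?B"
      show "((\<lambda>q. P (G q) * \<alpha> q + Q (G q) * \<beta> q) has_derivative
        (\<lambda>w. (P (G q) * \<alpha>' q + (Pu (G q) * \<alpha> q + Pv (G q) * \<beta> q) * \<alpha> q
             + (Q (G q) * \<beta>' q + (Qu (G q) * \<alpha> q + Qv (G q) * \<beta> q) * \<beta> q)) * fst w
           + (- P (G q) * \<beta>' q + (- Pu (G q) * \<beta> q + Pv (G q) * \<alpha> q) * \<alpha> q
             + (Q (G q) * \<alpha>' q + (- Qu (G q) * \<beta> q + Qv (G q) * \<alpha> q) * \<beta> q)) * snd w)) (at q)"
        by (rule has_derivative_eq_rhs[OF has_derivative_add[OF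
              has_derivative_mult[OF chain[OF P q] \<alpha>D[OF q]]
              has_derivative_mult[OF chain[OF Q q] \<beta>D[OF q]]]]) (auto simp: algebra_simps)
      show "((\<lambda>q. - P (G q) * \<beta> q + Q (G q) * \<alpha> q) has_derivative
        (\<lambda>w. (- P (G q) * \<beta>' q - (Pu (G q) * \<alpha> q + Pv (G q) * \<beta> q) * \<beta> q
             + (Q (G q) * \<alpha>' q + (Qu (G q) * \<alpha> q + Qv (G q) * \<beta> q) * \<alpha> q)) * fst w
           + (- P (G q) * \<alpha>' q - (- Pu (G q) * \<beta> q + Pv (G q) * \<alpha> q) * \<beta> q
             + (- Q (G q) * \<beta>' q + (- Qu (G q) * \<beta> q + Qv (G q) * \<alpha> q) * \<alpha> q)) * snd w)) (at q)"
        by (rule has_derivative_eq_rhs[OF has_derivative_add[OF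
              has_derivative_mult[OF has_derivative_minus[OF chain[OF P q]] \<beta>D[OF q]]
              has_derivative_mult[OF chain[OF Q q] \<alpha>D[OF q]]]]) (auto simp: algebra_simps)
      show "- P (G q) * \<beta>' q + (- Pu (G q) * \<beta> q + Pv (G q) * \<alpha> q) * \<alpha> q
             + (Q (G q) * \<alpha>' q + (- Qu (G q) * \<beta> q + Qv (G q) * \<alpha> q) * \<beta> q)
          = - P (G q) * \<beta>' q - (Pu (G q) * \<alpha> q + Pv (G q) * \<beta> q) * \<beta> q
             + (Q (G q) * \<alpha>' q + (Qu (G q) * \<alpha> q + Qv (G q) * \<beta> q) * \<alpha> q)"
        using closed[OF GS[OF q]] by (simp add: algebra_simps)
    qed (auto intro!: continuous_intros cont\<alpha> contBG cont contP contQ)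
    then obtain F where F: "\<And>q. q \<in> ?B \<Longrightarrow> (F has_derivative
        (\<lambda>w. (P (G q) * \<alpha> q + Q (G q) * \<beta> q) * fst w
           + (- P (G q) * \<beta> q + Q (G q) * \<alpha> q) * snd w)) (at q)" by blast
    have "((\<lambda>p. F (r (f (z p)))) has_derivative (\<lambda>w. P p * fst w + Q p * snd w)) (at p)"
      if p: "p \<in> S" for p
    proof -
      have zT: "z p \<in> T" using p by (simp add: T_def)
      let ?d = "deriv f (z p)"
      note fD = holomorphic_derivI[OF fg(1) oT zT, where T = UNIV]
      have HD: "((\<lambda>p. r (f (z p))) has_derivative
          (\<lambda>w. (Re ?d * fst w + - Im ?d * snd w, Im ?d * fst w + Re ?d * snd w))) (at p)"
        using has_derivative_Pair[OF holomorphic_coord_derivative[OF fD[unfolded z_def]]]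
        by (simp add: r_def z_def)
      let ?q = "r (f (z p))"
      have q: "?q \<in> ?B" using rB fg(3)[OF zT] by blast
      have Gq: "G ?q = p" using fg(4)[OF zT] by (simp add: G_def)
      have "((\<lambda>w. g (f w)) has_field_derivative deriv g (f (z p)) * ?d) (at (z p))"
        by (rule DERIV_chain2[OF holomorphic_derivI[OF fg(2) open_ball fg(3)[OF zT]] fD])
      then have "((\<lambda>w. w) has_field_derivative deriv g (f (z p)) * ?d) (at (z p))"
        by (rule has_field_derivative_transform_within_open[OF _ oT zT]) (use fg(4) in auto)
      then have "deriv g (f (z p)) * ?d = 1"
        using DERIV_ident DERIV_unique by blast
      then have inv: "\<alpha> ?q * Re ?d - \<beta> ?q * Im ?d = 1" "\<alpha> ?q * Im ?d + \<beta> ?q * Re ?d = 0"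
        by (auto simp: \<alpha>_def \<beta>_def complex_eq_iff)
      have eq: "(P p * \<alpha> ?q + Q p * \<beta> ?q) * (Re ?d * x + - Im ?d * y)
            + (- P p * \<beta> ?q + Q p * \<alpha> ?q) * (Im ?d * x + Re ?d * y)
          = P p * x + Q p * y" for x y
      proof -
        have "(P p * \<alpha> ?q + Q p * \<beta> ?q) * (Re ?d * x + - Im ?d * y)
            + (- P p * \<beta> ?q + Q p * \<alpha> ?q) * (Im ?d * x + Re ?d * y)
          = P p * ((\<alpha> ?q * Re ?d - \<beta> ?q * Im ?d) * x - (\<alpha> ?q * Im ?d + \<beta> ?q * Re ?d) * y)
          + Q p * ((\<alpha> ?q * Im ?d + \<beta> ?q * Re ?d) * x + (\<alpha> ?q * Re ?d - \<beta> ?q * Im ?d) * y)"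
          by (simp add: algebra_simps)
        then show ?thesis by (simp add: inv)
      qed
      show ?thesis
        by (rule has_derivative_eq_rhs[OF has_derivative_compose[OF HD F[OF q]]])
          (simp only: Gq fst_conv snd_conv eq)
    qed
    then show ?thesis by blast
  qed
qed

lemma smooth_closed_form_has_potential:
  fixes P Q :: "real \<times> real \<Rightarrow> real"
  assumes D: "open D" "simply_connected D" and P: "smooth_on D P" and Q: "smooth_on D Q"
    and closed: "\<And>p. p \<in> D \<Longrightarrow> dir_deriv (0, 1) P p = dir_deriv (1, 0) Q p"
  shows "\<exists>F. \<forall>p\<in>D. (F has_derivative (\<lambda>w. P p * fst w + Q p * snd w)) (at p)"
proof (rule poincare_simply_connected[OF D _ _ _ _ _ _ closed])
  have "(f has_derivative (\<lambda>w. dir_deriv (1, 0) f p * fst w + dir_deriv (0, 1) f p * snd w)) (at p)"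
    if p: "p \<in> D" and f: "smooth_on D f" for f :: "real \<times> real \<Rightarrow> real" and p
  proof -
    note d = smooth_on_differentiable[OF D(1) f p]
    show ?thesis
      by (rule has_derivative_eq_rhs[OF d[unfolded frechet_derivative_works]])
        (rule ext, rule dir_deriv_plane[OF d])
  qed
  then show "(P has_derivative (\<lambda>w. dir_deriv (1, 0) P p * fst w + dir_deriv (0, 1) P p * snd w)) (at p)"
    "(Q has_derivative (\<lambda>w. dir_deriv (1, 0) Q p * fst w + dir_deriv (0, 1) Q p * snd w)) (at p)"
    if "p \<in> D" for p using that P Q by blast+
qed (intro smooth_on_continuous smooth_on_dir_deriv P Q)+

section \<open>Line integrals\<close>

text \<open>The fundamental theorem of calculus along \<open>\<gamma>\<close>; the finitely many corners of a piecewise \<open>C\<^sup>1\<close> path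
  do not affect the integral.\<close>
lemma line_integral_exact:
  fixes F P Q :: "real \<times> real \<Rightarrow> real"
  assumes F: "\<And>p. p \<in> S \<Longrightarrow> (F has_derivative (\<lambda>w. P p * fst w + Q p * snd w)) (at p)"
    and \<gamma>: "valid_path \<gamma>" "path_image \<gamma> \<subseteq> S"
  shows "((\<lambda>t. P (\<gamma> t) * fst (vector_derivative \<gamma> (at t within {0..1}))
           + Q (\<gamma> t) * snd (vector_derivative \<gamma> (at t within {0..1})))
      has_integral F (pathfinish \<gamma>) - F (pathstart \<gamma>)) {0..1}"
proof -
  from \<gamma>(1) obtain k where k: "finite k" "\<And>t. t \<in> {0..1} - k \<Longrightarrow> \<gamma> differentiable (at t)"
    and c: "continuous_on {0..1} \<gamma>"
    unfolding valid_path_def piecewise_C1_differentiable_on_def C1_differentiable_on_eq by blast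
  have in_S: "\<gamma> t \<in> S" if "t \<in> {0..1}" for t
    using \<gamma>(2) that by (auto simp: path_image_def)
  have "continuous_on S F"
    using F by (meson continuous_at_imp_continuous_on has_derivative_continuous)
  then have "continuous_on {0..1} (\<lambda>t. F (\<gamma> t))"
    by (rule continuous_on_compose2[OF _ c]) (use in_S in auto)
  moreover have "((\<lambda>t. F (\<gamma> t)) has_vector_derivative
      P (\<gamma> t) * fst (vector_derivative \<gamma> (at t within {0..1}))
        + Q (\<gamma> t) * snd (vector_derivative \<gamma> (at t within {0..1}))) (at t)"
    if t: "t \<in> {0<..<1} - k" for t
  proof -
    have "at t within {0..1} = at t"
      using t by (intro at_within_interior) auto
    moreover have "(\<gamma> has_vector_derivative vector_derivative \<gamma> (at t)) (at t)"
      using k(2) t by (auto simp: vector_derivative_works)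
    ultimately have "(\<gamma> has_derivative
        (\<lambda>s. s *\<^sub>R vector_derivative \<gamma> (at t within {0..1}))) (at t)"
      by (simp add: has_vector_derivative_def)
    from has_derivative_compose[OF this F[OF in_S]] t
    show ?thesis unfolding has_vector_derivative_def
      by (auto elim!: has_derivative_eq_rhs simp: algebra_simps)
  qed
  ultimately show ?thesis
    using fundamental_theorem_of_calculus_interior_strong[OF k(1), of 0 1 "\<lambda>t. F (\<gamma> t)"]
    by (simp add: pathfinish_def pathstart_def)
qed

text \<open>Line integrals determine a function only at points that some piecewise \<open>C\<^sup>1\<close> path reaches; in an open
  connected set a polynomial path reaches every point.\<close>
lemma ex_valid_path:
  fixes D :: "(real \<times> real) set"
  assumes "open D" "connected D" "x \<in> D" "y \<in> D"
  shows "\<exists>\<gamma>. valid_path \<gamma> \<and> path_image \<gamma> \<subseteq> D \<and> pathstart \<gamma> = x \<and> pathfinish \<gamma> = y"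
  using connected_open_polynomial_connected[OF assms] valid_path_polynomial_function by blast

lemma is_line_integral_of_potential:
  assumes F: "\<And>p. p \<in> D \<Longrightarrow> (F has_derivative (\<lambda>w. P p * fst w + Q p * snd w)) (at p)"
    and \<alpha>: "\<And>p w. p \<in> D \<Longrightarrow> \<alpha> p w = P p * fst w + Q p * snd w"
  shows "is_line_integral_of D p\<^sub>0 c \<alpha> (\<lambda>p. F p - F p\<^sub>0 + c)"
  unfolding is_line_integral_of_def
proof (intro ballI allI impI, elim conjE)
  fix p \<gamma> assume \<gamma>: "valid_path \<gamma>" "path_image \<gamma> \<subseteq> D" "pathstart \<gamma> = p\<^sub>0" "pathfinish \<gamma> = p"
  have "\<gamma> t \<in> D" if "t \<in> {0..1}" for t
    using \<gamma>(2) that by (auto simp: path_image_def)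
  then have "\<alpha> (\<gamma> t) (vector_derivative \<gamma> (at t within {0..1}))
      = P (\<gamma> t) * fst (vector_derivative \<gamma> (at t within {0..1}))
        + Q (\<gamma> t) * snd (vector_derivative \<gamma> (at t within {0..1}))" if "t \<in> {0..1}" for t
    using \<alpha> that by blast
  from has_integral_eq[OF this[symmetric] line_integral_exact[OF F \<gamma>(1,2)]]
  show "((\<lambda>t. \<alpha> (\<gamma> t) (vector_derivative \<gamma> (at t within {0..1}))) has_integral
      F p - F p\<^sub>0 + c - c) {0..1}"
    by (simp add: \<gamma>)
qed

lemma is_line_integral_of_unique:
  assumes D: "open D" "connected D" "p\<^sub>0 \<in> D" and p: "p \<in> D"
    and "is_line_integral_of D p\<^sub>0 c \<alpha> F" "is_line_integral_of D p\<^sub>0 c \<beta> G"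
    and eq: "\<And>p w. p \<in> D \<Longrightarrow> \<alpha> p w = \<beta> p w"
  shows "F p = G p"
proof -
  obtain \<gamma> where \<gamma>: "valid_path \<gamma>" "path_image \<gamma> \<subseteq> D" "pathstart \<gamma> = p\<^sub>0" "pathfinish \<gamma> = p"
    using ex_valid_path[OF D p] by blast
  let ?v = "\<lambda>t. vector_derivative \<gamma> (at t within {0..1})"
  have F: "((\<lambda>t. \<alpha> (\<gamma> t) (?v t)) has_integral (F p - c)) {0..1}"
    and G: "((\<lambda>t. \<beta> (\<gamma> t) (?v t)) has_integral (G p - c)) {0..1}"
    using assms(5,6) p \<gamma> unfolding is_line_integral_of_def by blast+
  have "\<alpha> (\<gamma> t) (?v t) = \<beta> (\<gamma> t) (?v t)" if "t \<in> {0..1}" for t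
    using \<gamma>(2) that by (intro eq) (auto simp: path_image_def)
  from has_integral_eq[OF this F] show ?thesis
    using has_integral_unique[OF G] by force
qed

section \<open>The metric and the connection of \<open>G(\<mu>\<^sub>1,\<mu>\<^sub>2)\<close>\<close>

lemma three_eq_zero: "(3::3) = 0"
  by simp

lemma sum_3_from_0: "(\<Sum>i\<in>UNIV. f i) = f 0 + f 1 + f (2::3)"
  for f :: "3 \<Rightarrow> 'a::comm_monoid_add"
  by (simp add: sum_3 three_eq_zero add_ac)

lemma all_3_from_0: "(\<forall>i::3. P i) \<longleftrightarrow> P 0 \<and> P 1 \<and> P 2"
  by (auto simp: forall_3 three_eq_zero)

lemma matrix_inv_eq:
  assumes "A ** B = mat 1" "B ** A = mat 1"
  shows "matrix_inv A = B"
proof -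
  have "A ** matrix_inv A = mat 1 \<and> matrix_inv A ** A = mat 1"
    unfolding matrix_inv_def by (rule someI[of _ B]) (use assms in simp)
  then show ?thesis
    by (metis assms(2) matrix_mul_assoc matrix_mul_lid matrix_mul_rid)
qed

text \<open>Rescaling the coordinate vectors by \<open>e^(m x\<^sup>0)\<close> turns them into unit vectors of the left-invariant frame.\<close>
lemma exp_frame:
  "exp (- (2 * m * r)) * (exp (m * r) * a * (exp (m * r) * b)) = a * b" for m r a b :: real
proof -
  have "exp (- (2 * m * r)) * (exp (m * r) * exp (m * r)) = 1"
    by (simp flip: exp_add)
  then have "exp (- (2 * m * r)) * (exp (m * r) * exp (m * r)) * (a * b) = a * b" by simp
  then show ?thesis by (simp only: mult_ac)
qed

lemma G_metric_frame:
  "G_metric \<mu>\<^sub>1 \<mu>\<^sub>2 x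
     (vec3 a0 (exp (\<mu>\<^sub>1 * x $ 0) * a1) (exp (\<mu>\<^sub>2 * x $ 0) * a2))
     (vec3 b0 (exp (\<mu>\<^sub>1 * x $ 0) * b1) (exp (\<mu>\<^sub>2 * x $ 0) * b2))
   = - (a0 * b0) + a1 * b1 + a2 * b2"
  by (simp add: G_metric_def exp_frame)

text \<open>The diagonal entries of the metric. They satisfy
  \<open>\<partial>\<^sub>0 G_diag i = - 2 G_weight i G_diag i\<close>, where the weights are \<open>(0, \<mu>\<^sub>1, \<mu>\<^sub>2)\<close>, and do not depend
  on the other two coordinates.\<close>
definition G_diag :: "real \<Rightarrow> real \<Rightarrow> 3 \<Rightarrow> real^3 \<Rightarrow> real"
  where "G_diag \<mu>\<^sub>1 \<mu>\<^sub>2 i x =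
    (if i = 0 then - 1 else if i = 1 then exp (- 2 * \<mu>\<^sub>1 * x $ 0) else exp (- 2 * \<mu>\<^sub>2 * x $ 0))"

definition G_weight :: "real \<Rightarrow> real \<Rightarrow> 3 \<Rightarrow> real"
  where "G_weight \<mu>\<^sub>1 \<mu>\<^sub>2 i = (if i = 0 then 0 else if i = 1 then \<mu>\<^sub>1 else \<mu>\<^sub>2)"

lemma G_diag_nonzero: "G_diag \<mu>\<^sub>1 \<mu>\<^sub>2 i x \<noteq> 0"
  by (simp add: G_diag_def)

lemma G_matrix_diag: "G_matrix \<mu>\<^sub>1 \<mu>\<^sub>2 x $ i $ j = (if i = j then G_diag \<mu>\<^sub>1 \<mu>\<^sub>2 i x else 0)"
proof -
  have "\<forall>i j. G_matrix \<mu>\<^sub>1 \<mu>\<^sub>2 x $ i $ j = (if i = j then G_diag \<mu>\<^sub>1 \<mu>\<^sub>2 i x else 0)"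
    by (simp add: all_3_from_0 G_matrix_def G_metric_def G_diag_def axis_def)
  then show ?thesis by blast
qed

lemma G_matrix_inv:
  "matrix_inv (G_matrix \<mu>\<^sub>1 \<mu>\<^sub>2 x) $ i $ j = (if i = j then 1 / G_diag \<mu>\<^sub>1 \<mu>\<^sub>2 i x else 0)"
proof -
  have "matrix_inv (G_matrix \<mu>\<^sub>1 \<mu>\<^sub>2 x) = (\<chi> i j. if i = j then 1 / G_diag \<mu>\<^sub>1 \<mu>\<^sub>2 i x else 0)"
    by (rule matrix_inv_eq)
      (auto simp: vec_eq_iff matrix_matrix_mult_def G_matrix_diag mat_def G_diag_nonzero
        if_distrib[of "\<lambda>a. a * _"] if_distrib[of "\<lambda>a. _ * a"] cong: if_cong)
  then show ?thesis by simp
qed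

lemma dir_deriv_G_matrix:
  "dir_deriv (axis k 1) (\<lambda>y. G_matrix \<mu>\<^sub>1 \<mu>\<^sub>2 y $ i $ j) x =
    (if i = j \<and> k = 0 then - 2 * G_weight \<mu>\<^sub>1 \<mu>\<^sub>2 i * G_diag \<mu>\<^sub>1 \<mu>\<^sub>2 i x else 0)"
proof -
  have e: "((\<lambda>y::real^3. exp (- 2 * m * y $ 0)) has_derivative
      (\<lambda>w. - 2 * m * w $ 0 * exp (- 2 * m * x $ 0))) (at x)" for m :: real
    by (auto intro!: derivative_eq_intros bounded_linear_imp_has_derivative bounded_linear_vec_nth)
  have "((\<lambda>y. G_diag \<mu>\<^sub>1 \<mu>\<^sub>2 i y) has_derivative
      (\<lambda>w. - 2 * G_weight \<mu>\<^sub>1 \<mu>\<^sub>2 i * w $ 0 * G_diag \<mu>\<^sub>1 \<mu>\<^sub>2 i x)) (at x)"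
    using e[of \<mu>\<^sub>1] e[of \<mu>\<^sub>2] by (auto simp: G_diag_def G_weight_def)
  then have "((\<lambda>y. G_matrix \<mu>\<^sub>1 \<mu>\<^sub>2 y $ i $ j) has_derivative
      (\<lambda>w. if i = j then - 2 * G_weight \<mu>\<^sub>1 \<mu>\<^sub>2 i * w $ 0 * G_diag \<mu>\<^sub>1 \<mu>\<^sub>2 i x else 0)) (at x)"
    by (cases "i = j") (simp_all add: G_matrix_diag)
  from dir_deriv_eq[OF this, of "axis k 1"] show ?thesis
    by (simp add: axis_def)
qed

lemma christoffel_eq:
  "christoffel \<mu>\<^sub>1 \<mu>\<^sub>2 k i j x =
    ((if i = j \<and> k = 0 then G_weight \<mu>\<^sub>1 \<mu>\<^sub>2 i * G_diag \<mu>\<^sub>1 \<mu>\<^sub>2 i x else 0)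
     - (if j = k \<and> i = 0 then G_weight \<mu>\<^sub>1 \<mu>\<^sub>2 k * G_diag \<mu>\<^sub>1 \<mu>\<^sub>2 k x else 0)
     - (if i = k \<and> j = 0 then G_weight \<mu>\<^sub>1 \<mu>\<^sub>2 k * G_diag \<mu>\<^sub>1 \<mu>\<^sub>2 k x else 0)) / G_diag \<mu>\<^sub>1 \<mu>\<^sub>2 k x"
proof -
  have T: "(\<Sum>l\<in>UNIV. matrix_inv (G_matrix \<mu>\<^sub>1 \<mu>\<^sub>2 x) $ k $ l * T l) = T k / G_diag \<mu>\<^sub>1 \<mu>\<^sub>2 k x" for T
    by (simp add: G_matrix_inv if_distrib[of "\<lambda>a. a * _"] cong: if_cong)
  let ?h = "\<lambda>i. G_weight \<mu>\<^sub>1 \<mu>\<^sub>2 i * G_diag \<mu>\<^sub>1 \<mu>\<^sub>2 i x"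
  have h: "(if j = k \<and> i = 0 then - 2 * G_weight \<mu>\<^sub>1 \<mu>\<^sub>2 j * G_diag \<mu>\<^sub>1 \<mu>\<^sub>2 j x else 0) = - 2 * (if j = k \<and> i = 0 then ?h k else 0)"
    "(if i = k \<and> j = 0 then - 2 * G_weight \<mu>\<^sub>1 \<mu>\<^sub>2 i * G_diag \<mu>\<^sub>1 \<mu>\<^sub>2 i x else 0) = - 2 * (if i = k \<and> j = 0 then ?h k else 0)"
    "(if i = j \<and> k = 0 then - 2 * G_weight \<mu>\<^sub>1 \<mu>\<^sub>2 i * G_diag \<mu>\<^sub>1 \<mu>\<^sub>2 i x else 0) = - 2 * (if i = j \<and> k = 0 then ?h i else 0)"
    by auto
  have c: "1 / 2 * ((- 2 * a + - 2 * b - - 2 * c) / d) = (c - a - b) / d" for a b c d :: real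
    by (simp add: diff_divide_distrib add_divide_distrib)
  show ?thesis
    unfolding christoffel_def dir_deriv_G_matrix T h c ..
qed

text \<open>The only symbols that do not vanish identically in \<open>\<mu>\<^sub>1, \<mu>\<^sub>2\<close> are \<open>\<Gamma>\<^sup>0\<^sub>i\<^sub>i = - \<mu>\<^sub>i e^(- 2 \<mu>\<^sub>i x\<^sup>0)\<close> and
  \<open>\<Gamma>\<^sup>i\<^sub>0\<^sub>i = \<Gamma>\<^sup>i\<^sub>i\<^sub>0 = - \<mu>\<^sub>i\<close> for \<open>i = 1, 2\<close>.\<close>
lemma christoffel_contract:
  "(\<Sum>i\<in>UNIV. \<Sum>j\<in>UNIV. christoffel \<mu>\<^sub>1 \<mu>\<^sub>2 0 i j x * a $ i * b $ j)
     = - (\<mu>\<^sub>1 * exp (- 2 * \<mu>\<^sub>1 * x $ 0) * (a $ 1 * b $ 1)) - \<mu>\<^sub>2 * exp (- 2 * \<mu>\<^sub>2 * x $ 0) * (a $ 2 * b $ 2)"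
  "(\<Sum>i\<in>UNIV. \<Sum>j\<in>UNIV. christoffel \<mu>\<^sub>1 \<mu>\<^sub>2 1 i j x * a $ i * b $ j)
     = - (\<mu>\<^sub>1 * (a $ 0 * b $ 1 + a $ 1 * b $ 0))"
  "(\<Sum>i\<in>UNIV. \<Sum>j\<in>UNIV. christoffel \<mu>\<^sub>1 \<mu>\<^sub>2 2 i j x * a $ i * b $ j)
     = - (\<mu>\<^sub>2 * (a $ 0 * b $ 2 + a $ 2 * b $ 0))"
  by (simp_all add: sum_3_from_0 christoffel_eq G_diag_def G_weight_def algebra_simps)

text \<open>For a metric with null coordinate vectors the trace therefore involves mixed terms only.\<close>
lemma matrix_inv_antidiagonal:
  fixes A :: "real^2^2"
  assumes "A $ 1 $ 1 = 0" "A $ 2 $ 2 = 0" "A $ 1 $ 2 = f" "A $ 2 $ 1 = f" "f \<noteq> 0"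
  shows "matrix_inv A $ 1 $ 1 = 0" "matrix_inv A $ 2 $ 2 = 0"
proof -
  have "matrix_inv A = (\<chi> i j. if i = j then 0 else 1 / f)"
    by (rule matrix_inv_eq)
      (use assms in \<open>auto simp: vec_eq_iff forall_2 matrix_matrix_mult_def mat_def sum_2\<close>)
  then show "matrix_inv A $ 1 $ 1 = 0" "matrix_inv A $ 2 $ 2 = 0" by simp_all
qed

section \<open>Two integral lemmas for the first variation\<close>

text \<open>Integration over a box containing the support in its interior, first along the direction of the derivative: the inner
  integral is a difference of two boundary values of \<open>f\<close>, which are zero.\<close>
lemma has_integral_partials_zero:
  fixes f fx fy :: "real \<times> real \<Rightarrow> real"
  assumes K: "compact K" and zero: "\<And>q. q \<notin> K \<Longrightarrow> f q = 0"
    and d: "\<And>q. (f has_derivative (\<lambda>w. fx q * fst w + fy q * snd w)) (at q)"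
    and cont: "continuous_on UNIV fx" "continuous_on UNIV fy"
  shows "(fx has_integral 0) K" "(fy has_integral 0) K"
proof -
  obtain a where a: "K \<subseteq> box (- a) a"
    using bounded_subset_box_symmetric[OF compact_imp_bounded[OF K]] by blast
  obtain a1 a2 where aa: "a = (a1, a2)" by (cases a)
  have edge: "f (x, a2) = 0" "f (x, - a2) = 0" "f (a1, x) = 0" "f (- a1, x) = 0" for x
    using a by (auto intro!: zero simp: aa box_prod)
  have off: "fx q = 0" "fy q = 0" if "q \<notin> K" for q
  proof -
    have "(f has_derivative (\<lambda>w. 0)) (at q)"
      by (rule has_derivative_transform_within_open[of "\<lambda>_. 0" _ _ _ "- K"])
        (use that K zero compact_imp_closed in auto)
    note eq = has_derivative_unique[OF this d, THEN fun_cong]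
    show "fx q = 0" "fy q = 0"
      using eq[of "(1, 0)"] eq[of "(0, 1)"] by simp_all
  qed
  have dx: "((\<lambda>x. f (x, y)) has_vector_derivative fx (x, y)) (at x within S)"
    and dy: "((\<lambda>y. f (x, y)) has_vector_derivative fy (x, y)) (at y within S)" for x y S
  proof -
    have "((\<lambda>x. (x, y)) has_derivative (\<lambda>h. (h, 0))) (at x within S)"
      by (auto intro!: derivative_eq_intros)
    from has_derivative_compose[OF this d]
    show "((\<lambda>x. f (x, y)) has_vector_derivative fx (x, y)) (at x within S)"
      by (simp add: has_vector_derivative_def mult.commute)
    have "((\<lambda>y. (x, y)) has_derivative (\<lambda>h. (0, h))) (at y within S)"
      by (auto intro!: derivative_eq_intros)
    from has_derivative_compose[OF this d]
    show "((\<lambda>y. f (x, y)) has_vector_derivative fy (x, y)) (at y within S)"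
      by (simp add: has_vector_derivative_def mult.commute)
  qed
  have ftc: "integral {- b..b} g' = 0"
    if "\<And>x. (g has_vector_derivative g' x) (at x within {- b..b})" "g b = 0" "g (- b) = 0"
    for g g' :: "real \<Rightarrow> real" and b
  proof (cases "- b \<le> b")
    case True
    from fundamental_theorem_of_calculus[OF True, of g g'] that show ?thesis
      by (simp add: integral_unique)
  qed simp
  have contc: "continuous_on S fx" "continuous_on S fy" for S
    using cont continuous_on_subset by blast+
  have iy: "integral (cbox (- a) a) fy = 0"
    using integral_prod_continuous[of "- a1" "- a2" a1 a2 fy] ftc[OF dy edge(1,2)]
    by (simp add: aa contc)
  have "integral (cbox (- a) a) fx
      = integral (cbox (- a1) a1) (\<lambda>x. integral (cbox (- a2) a2) (\<lambda>y. fx (x, y)))"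
    using integral_prod_continuous[of "- a1" "- a2" a1 a2 fx] by (simp add: aa contc)
  also have "\<dots> = integral (cbox (- a2) a2) (\<lambda>y. integral (cbox (- a1) a1) (\<lambda>x. fx (x, y)))"
    by (rule integral_swap_continuous) (simp add: contc case_prod_unfold)
  also have "\<dots> = 0" using ftc[OF dx edge(3,4)] by simp
  finally have ix: "integral (cbox (- a) a) fx = 0" .
  have "(g has_integral 0) K"
    if g: "continuous_on (cbox (- a) a) g" "integral (cbox (- a) a) g = 0" "\<And>q. q \<notin> K \<Longrightarrow> g q = 0"
    for g :: "real \<times> real \<Rightarrow> real"
  proof -
    have "(g has_integral 0) (cbox (- a) a)"
      using integrable_integral[OF integrable_continuous[OF g(1)]] g(2) by simp
    moreover have "K \<subseteq> cbox (- a) a" using a box_subset_cbox by blast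
    moreover have "(\<lambda>q. if q \<in> K then g q else 0) = g" using g(3) by auto
    ultimately show ?thesis
      using has_integral_restrict[of K "cbox (- a) a" g 0] by simp
  qed
  from this[OF contc(1) ix off(1)] this[OF contc(2) iy off(2)]
  show "(fx has_integral 0) K" "(fy has_integral 0) K" by auto
qed

text \<open>Compactly supported data on \<open>D\<close> are extended by zero to the plane; there \<open>U\<close> is the domain and \<open>V\<close> the
  complement of the support.\<close>
lemma continuous_on_zero_extension:
  fixes g :: "'a::topological_space \<Rightarrow> 'b::real_normed_vector"
  assumes "open U" "open V" "continuous_on U f"
    and "\<And>x. x \<in> U \<Longrightarrow> g x = f x" "\<And>x. x \<in> V \<Longrightarrow> g x = 0"
  shows "continuous_on (U \<union> V) g"
proof (rule continuous_on_open_Un[OF assms(1,2)])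
  show "continuous_on U g" using assms(3,4) continuous_on_cong by metis
  show "continuous_on V g" using assms(5) continuous_on_cong[of V V g "\<lambda>_. 0"] by simp
qed

lemma bounded_linear_uv: "bounded_linear uv_of_tx"
  unfolding uv_of_tx_def case_prod_unfold
  by (intro bounded_linear_Pair bounded_linear_add bounded_linear_minus bounded_linear_fst bounded_linear_snd)

lemma continuous_on_uv: "continuous_on A uv_of_tx"
  by (rule linear_continuous_on[OF bounded_linear_uv])

lemma compact_uv_vimage:
  assumes "compact K" shows "compact (uv_of_tx -` K)"
proof -
  have "uv_of_tx -` K = (\<lambda>(u, v). ((u - v) / 2, (u + v) / 2)) ` K"
  proof (intro equalityI subsetI)
    fix q assume "q \<in> uv_of_tx -` K"
    moreover have "q = (\<lambda>(u, v). ((u - v) / 2, (u + v) / 2)) (uv_of_tx q)"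
      by (cases q) (simp add: uv_of_tx_def)
    ultimately show "q \<in> (\<lambda>(u, v). ((u - v) / 2, (u + v) / 2)) ` K" by blast
  next
    fix q assume "q \<in> (\<lambda>(u, v). ((u - v) / 2, (u + v) / 2)) ` K"
    then obtain u v where "(u, v) \<in> K" "q = ((u - v) / 2, (u + v) / 2)" by auto
    moreover have "- ((u - v) / 2) + (u + v) / 2 = v" "(u - v) / 2 + (u + v) / 2 = u"
      by (simp_all add: field_simps)
    ultimately show "q \<in> uv_of_tx -` K" by (simp add: uv_of_tx_def)
  qed
  moreover have "compact ((\<lambda>(u, v). ((u - v) / 2, (u + v) / 2)) ` K)"
    unfolding case_prod_unfold
    by (intro compact_continuous_image assms continuous_intros) auto
  ultimately show ?thesis by simp
qed

text \<open>The integrals are taken in the \<open>(t,x)\<close>-plane while \<open>A\<close> is differentiated in \<open>(u,v)\<close>. Since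
  \<open>\<partial>\<^sub>t = \<partial>\<^sub>u - \<partial>\<^sub>v\<close> and \<open>\<partial>\<^sub>x = \<partial>\<^sub>u + \<partial>\<^sub>v\<close>, both null derivatives are combinations of the
  coordinate derivatives of the zero extension of \<open>A\<close>, so no change of variables in the integral
  is needed.\<close>
lemma integral_dir_deriv_zero:
  fixes A :: "real \<times> real \<Rightarrow> real"
  assumes D: "open D" and K: "compact K" "K \<subseteq> D" and A: "smooth_on D A"
    and zero: "\<And>p. p \<in> D - K \<Longrightarrow> A p = 0"
  shows "((\<lambda>q. dir_deriv (1, 0) A (uv_of_tx q)) has_integral 0) (uv_of_tx -` K)"
    and "((\<lambda>q. dir_deriv (0, 1) A (uv_of_tx q)) has_integral 0) (uv_of_tx -` K)"
proof -
  let ?T = uv_of_tx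
  define B where "B = (\<lambda>q. if ?T q \<in> D then A (?T q) else 0)"
  define B' where "B' = (\<lambda>e q. if ?T q \<in> D then dir_deriv (?T e) A (?T q) else 0)"
  have K': "compact (?T -` K)" by (rule compact_uv_vimage[OF K(1)])
  have D': "open (?T -` D)" by (rule open_vimage[OF D continuous_on_uv])
  have V': "open (- (?T -` K))" using K' compact_imp_closed by blast
  have cover: "UNIV = ?T -` D \<union> - (?T -` K)" using K(2) by auto
  have zero': "dir_deriv e A p = 0" if "p \<in> D - K" for e p
  proof -
    have "dir_deriv e A p = dir_deriv e (\<lambda>_. 0) p"
      using D K(1) that by (intro dir_deriv_cong[of "D - K"] zero) (auto intro: open_Diff compact_imp_closed)
    then show ?thesis by (simp add: frechet_derivative_const)
  qed
  have val: "B' (1, 0) q = dir_deriv (1, 0) A (?T q) - dir_deriv (0, 1) A (?T q)"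
    "B' (0, 1) q = dir_deriv (1, 0) A (?T q) + dir_deriv (0, 1) A (?T q)" if "?T q \<in> D" for q
  proof -
    note d = smooth_on_differentiable[OF D A that]
    have "?T (1, 0) = (1, - 1)" "?T (0, 1) = (1, 1)" by (simp_all add: uv_of_tx_def)
    then show "B' (1, 0) q = dir_deriv (1, 0) A (?T q) - dir_deriv (0, 1) A (?T q)"
      "B' (0, 1) q = dir_deriv (1, 0) A (?T q) + dir_deriv (0, 1) A (?T q)"
      using that dir_deriv_plane[OF d, of "(1, - 1)"] dir_deriv_plane[OF d, of "(1, 1)"]
      by (simp_all add: B'_def)
  qed
  have valK: "?T q \<in> D" if "q \<in> ?T -` K" for q using that K(2) by auto
  have der: "(B has_derivative (\<lambda>w. B' (1, 0) q * fst w + B' (0, 1) q * snd w)) (at q)" for q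
  proof (cases "q \<in> ?T -` D")
    case True
    then have d: "A differentiable at (?T q)" using smooth_on_differentiable[OF D A] by simp
    have dA: "((\<lambda>q. A (?T q)) has_derivative (\<lambda>w. dir_deriv (?T w) A (?T q))) (at q)"
      using has_derivative_compose[OF bounded_linear_imp_has_derivative[OF bounded_linear_uv]]
        d[unfolded frechet_derivative_works] by blast
    have "dir_deriv (?T w) A (?T q) = B' (1, 0) q * fst w + B' (0, 1) q * snd w" for w
      unfolding dir_deriv_plane[OF d, of "?T w"] using True
      by (simp add: val) (simp add: uv_of_tx_def case_prod_unfold algebra_simps)
    with dA have "((\<lambda>q. A (?T q)) has_derivative
        (\<lambda>w. B' (1, 0) q * fst w + B' (0, 1) q * snd w)) (at q)" by simp
    then show ?thesis
      by (rule has_derivative_transform_within_open[OF _ D' True]) (simp add: B_def)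
  next
    case False
    then have "q \<in> - (?T -` K)" using K(2) by auto
    then have "(B has_derivative (\<lambda>w. 0)) (at q)"
      by (intro has_derivative_transform_within_open[OF has_derivative_const V'])
        (auto simp: B_def zero)
    with False show ?thesis by (simp add: B'_def)
  qed
  have cont: "continuous_on UNIV (B' e)" for e
    unfolding cover
  proof (rule continuous_on_zero_extension[OF D' V'])
    show "continuous_on (?T -` D) (\<lambda>q. dir_deriv (?T e) A (?T q))"
      by (rule continuous_on_compose2[OF smooth_on_continuous[OF smooth_on_dir_deriv[OF A]] continuous_on_uv])
        auto
  qed (auto simp: B'_def zero')
  have hi: "(B' (1, 0) has_integral 0) (?T -` K)" "(B' (0, 1) has_integral 0) (?T -` K)"
    by (rule has_integral_partials_zero[OF K' _ der cont cont], use zero in \<open>auto simp: B_def\<close>)+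
  have eq: "dir_deriv (1, 0) A (?T q) = (1 / 2) *\<^sub>R (B' (1, 0) q + B' (0, 1) q)"
    "dir_deriv (0, 1) A (?T q) = (1 / 2) *\<^sub>R (B' (0, 1) q - B' (1, 0) q)" if "q \<in> ?T -` K" for q
    using val[OF valK[OF that]] by simp_all
  show "((\<lambda>q. dir_deriv (1, 0) A (?T q)) has_integral 0) (?T -` K)"
    using has_integral_cmul[OF has_integral_add[OF hi], of "1 / 2"]
    by (subst has_integral_cong[OF eq(1)]) simp_all
  show "((\<lambda>q. dir_deriv (0, 1) A (?T q)) has_integral 0) (?T -` K)"
    using has_integral_cmul[OF has_integral_diff[OF hi(2,1)], of "1 / 2"]
    by (subst has_integral_cong[OF eq(2)]) simp_all
qed

lemma has_real_derivative_slice: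
  fixes R :: "real \<times> 'a::real_normed_vector \<Rightarrow> real"
  assumes "R differentiable at (s, p)"
  shows "((\<lambda>s. R (s, p)) has_real_derivative dir_deriv (1, 0) R (s, p)) (at s)"
proof -
  from assms have R: "(R has_derivative frechet_derivative R (at (s, p))) (at (s, p))"
    using frechet_derivative_works by blast
  then interpret bounded_linear "frechet_derivative R (at (s, p))" by (rule has_derivative_bounded_linear)
  have "((\<lambda>s. (s, p)) has_derivative (\<lambda>h. (h, 0))) (at s)"
    by (auto intro!: derivative_eq_intros)
  from has_derivative_compose[OF this R]
  have "((\<lambda>s. R (s, p)) has_derivative (\<lambda>h. dir_deriv (h, 0) R (s, p))) (at s)" .
  moreover have "(\<lambda>h. dir_deriv (h, 0) R (s, p)) = (*) (dir_deriv (1, 0) R (s, p))"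
  proof
    fix h show "dir_deriv (h, 0) R (s, p) = dir_deriv (1, 0) R (s, p) * h"
      using scaleR[of h "(1, 0)"] unfolding scaleR_Pair by (simp only: real_scaleR_def mult_1_right mult_1_left mult.commute scaleR_zero_right)
  qed
  ultimately show ?thesis unfolding has_field_derivative_def by (rule has_derivative_eq_rhs)
qed

text \<open>\<open>K\<close> is an arbitrary compact set, so the integrals are first rewritten as integrals over a box of the
  zero extension of \<open>R\<close>, which is continuously differentiable in \<open>s\<close> because \<open>R\<close> vanishes off \<open>K\<close> for every \<open>s\<close>.
  Differentiation under the integral sign then applies.\<close>
lemma derivative_of_integral_zero:
  fixes R :: "real \<times> (real \<times> real) \<Rightarrow> real" and T :: "real \<times> real \<Rightarrow> real \<times> real"
  assumes D: "open D" and K: "compact K" "K \<subseteq> D" and \<epsilon>: "0 < \<epsilon>"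
    and R: "smooth_on ({-\<epsilon><..<\<epsilon>} \<times> D) R"
    and zero: "\<And>s p. s \<in> {-\<epsilon><..<\<epsilon>} \<Longrightarrow> p \<in> D - K \<Longrightarrow> R (s, p) = 0"
    and crit: "\<And>p. p \<in> D \<Longrightarrow> ((\<lambda>s. R (s, p)) has_real_derivative 0) (at 0)"
    and T: "continuous_on UNIV T" "compact (T -` K)"
  shows "((\<lambda>s. integral (T -` K) (\<lambda>q. R (s, T q))) has_real_derivative 0) (at 0)"
proof -
  define I where "I = {-\<epsilon><..<\<epsilon>}"
  have I: "open I" "convex I" "0 \<in> I" using \<epsilon> by (auto simp: I_def)
  note R = R[folded I_def] and zero = zero[folded I_def]
  have oID: "open (I \<times> D)" by (intro open_Times I D)
  obtain a b where ab: "T -` K \<subseteq> cbox a b"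
    using bounded_subset_cbox_symmetric[OF compact_imp_bounded[OF T(2)]] by metis
  define r where "r = (\<lambda>s q. if T q \<in> D then R (s, T q) else 0)"
  define r' where "r' = (\<lambda>s q. if T q \<in> D then dir_deriv (1, 0) R (s, T q) else 0)"
  have dR: "((\<lambda>s. R (s, p)) has_real_derivative dir_deriv (1, 0) R (s, p)) (at s)"
    if "s \<in> I" "p \<in> D" for s p
    using that by (intro has_real_derivative_slice smooth_on_differentiable[OF oID R]) auto
  have crit': "dir_deriv (1, 0) R (0, p) = 0" if "p \<in> D" for p
    using DERIV_unique[OF dR[OF I(3) that] crit[OF that]] .
  have zero': "dir_deriv (1, 0) R (s, p) = 0" if "s \<in> I" "p \<in> D - K" for s p
  proof -
    have "((\<lambda>s. R (s, p)) has_real_derivative 0) (at s)"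
      by (rule has_field_derivative_transform_within_open[of "\<lambda>_. 0" _ _ I])
        (use that I zero in auto)
    from DERIV_unique[OF dR this] that show ?thesis by auto
  qed
  have D': "open (T -` D)" by (rule open_vimage[OF D T(1)])
  have V': "open (- (T -` K))" using T(2) compact_imp_closed by blast
  have contT: "continuous_on A T" for A using T(1) continuous_on_subset by blast
  have r_cont: "continuous_on UNIV (r s)" if "s \<in> I" for s
  proof -
    have "continuous_on (T -` D \<union> - (T -` K)) (r s)"
    proof (rule continuous_on_zero_extension[OF D' V'])
      show "continuous_on (T -` D) (\<lambda>q. R (s, T q))"
        by (rule continuous_on_compose2[OF smooth_on_continuous[OF R]])
          (use that in \<open>auto intro!: continuous_intros contT\<close>)
    qed (auto simp: r_def zero that)
    moreover have "T -` D \<union> - (T -` K) = UNIV" using K(2) by auto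
    ultimately show ?thesis by simp
  qed
  have r'_cont: "continuous_on (I \<times> UNIV) (\<lambda>(s, q). r' s q)"
  proof -
    have "continuous_on (I \<times> T -` D \<union> I \<times> - (T -` K)) (\<lambda>(s, q). r' s q)"
    proof (rule continuous_on_zero_extension)
      show "continuous_on (I \<times> T -` D) (\<lambda>z. dir_deriv (1, 0) R (fst z, T (snd z)))"
        by (rule continuous_on_compose2[OF smooth_on_continuous[OF smooth_on_dir_deriv[OF R]]])
          (auto intro!: continuous_intros continuous_on_compose2[OF T(1)])
    qed (auto simp: r'_def zero' intro!: open_Times I D' V')
    moreover have "I \<times> T -` D \<union> I \<times> - (T -` K) = I \<times> UNIV" using K(2) by auto
    ultimately show ?thesis by simp
  qed
  have "((\<lambda>s. integral (cbox a b) (r s)) has_field_derivative integral (cbox a b) (r' 0)) (at 0 within I)"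
  proof (rule leibniz_rule_field_derivative)
    show "((\<lambda>s. r s q) has_field_derivative r' s q) (at s within I)" if "s \<in> I" for s q
      using has_field_derivative_at_within[OF dR[OF that, of "T q"]]
      by (cases "T q \<in> D") (simp_all add: r_def r'_def)
    show "r s integrable_on cbox a b" if "s \<in> I" for s
      by (rule integrable_continuous[OF continuous_on_subset[OF r_cont[OF that]]]) simp
    show "continuous_on (I \<times> cbox a b) (\<lambda>(s, q). r' s q)"
      by (rule continuous_on_subset[OF r'_cont]) auto
  qed (use I in auto)
  moreover have "r' 0 = (\<lambda>q. 0)" by (auto simp: r'_def crit')
  ultimately have "((\<lambda>s. integral (cbox a b) (r s)) has_real_derivative 0) (at 0)"
    using at_within_open[OF I(3,1)] by simp
  then show ?thesis
  proof (rule has_field_derivative_transform_within_open[OF _ I(1,3)])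
    fix s assume s: "s \<in> I"
    have "(\<lambda>q. if q \<in> cbox a b then r s q else 0) = (\<lambda>q. if q \<in> T -` K then R (s, T q) else 0)"
    proof
      fix q show "(if q \<in> cbox a b then r s q else 0) = (if q \<in> T -` K then R (s, T q) else 0)"
      proof (cases "T q \<in> K")
        case True
        then have "q \<in> cbox a b" "T q \<in> D" using ab K(2) by auto
        with True show ?thesis by (simp add: r_def)
      next
        case False
        then have "r s q = 0" using zero[OF s, of "T q"] by (simp add: r_def)
        with False show ?thesis by simp
      qed
    qed
    then show "integral (cbox a b) (r s) = integral (T -` K) (\<lambda>q. R (s, T q))"
      unfolding integral_restrict_UNIV[of "cbox a b", symmetric]
        integral_restrict_UNIV[of "T -` K", symmetric] by (rule arg_cong)
  qed
qed

lemma set_integral_compact: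
  fixes g :: "real \<times> real \<Rightarrow> real"
  assumes "compact K" "continuous_on K g"
  shows "g integrable_on K" "(LINT q:K|lborel. g q) = integral K g"
proof -
  have "set_integrable lborel K g"
    unfolding set_integrable_def by (rule borel_integrable_compact[OF assms])
  from set_borel_integral_eq_integral[OF this]
  show "g integrable_on K" "(LINT q:K|lborel. g q) = integral K g" .
qed

section \<open>The surface defined by a solution of the structure equations\<close>

text \<open>The coordinate form of the hypotheses together with the differentials of the components of \<open>\<phi>\<close>, which
  say that \<open>\<phi>\<close> is obtained by integration. The values of \<open>\<phi>\<close> outside \<open>D\<close> stay arbitrary.\<close>
locale integrated_data =
  fixes \<mu>\<^sub>1 \<mu>\<^sub>2 :: real
    and D :: "(real \<times> real) set"
    and \<xi> \<eta> :: "3 \<Rightarrow> real \<times> real \<Rightarrow> real"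
    and \<phi> :: "real \<times> real \<Rightarrow> real^3"
  assumes open_D: "open D"
    and smooth_\<xi>: "\<And>i. smooth_on D (\<xi> i)"
    and smooth_\<eta>: "\<And>i. smooth_on D (\<eta> i)"
    and \<xi>_v: "\<And>p. p \<in> D \<Longrightarrow> dir_deriv (0, 1) (\<xi> 0) p = \<mu>\<^sub>1 * (\<xi> 1 p * \<eta> 1 p) + \<mu>\<^sub>2 * (\<xi> 2 p * \<eta> 2 p)"
      "\<And>p. p \<in> D \<Longrightarrow> dir_deriv (0, 1) (\<xi> 1) p = \<mu>\<^sub>1 * (\<xi> 0 p * \<eta> 1 p)"
      "\<And>p. p \<in> D \<Longrightarrow> dir_deriv (0, 1) (\<xi> 2) p = \<mu>\<^sub>2 * (\<xi> 0 p * \<eta> 2 p)"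
    and \<eta>_u: "\<And>p. p \<in> D \<Longrightarrow> dir_deriv (1, 0) (\<eta> 0) p = \<mu>\<^sub>1 * (\<xi> 1 p * \<eta> 1 p) + \<mu>\<^sub>2 * (\<xi> 2 p * \<eta> 2 p)"
      "\<And>p. p \<in> D \<Longrightarrow> dir_deriv (1, 0) (\<eta> 1) p = \<mu>\<^sub>1 * (\<xi> 1 p * \<eta> 0 p)"
      "\<And>p. p \<in> D \<Longrightarrow> dir_deriv (1, 0) (\<eta> 2) p = \<mu>\<^sub>2 * (\<xi> 2 p * \<eta> 0 p)"
    and null: "\<And>p. p \<in> D \<Longrightarrow> - (\<xi> 0 p * \<xi> 0 p) + \<xi> 1 p * \<xi> 1 p + \<xi> 2 p * \<xi> 2 p = 0"
      "\<And>p. p \<in> D \<Longrightarrow> - (\<eta> 0 p * \<eta> 0 p) + \<eta> 1 p * \<eta> 1 p + \<eta> 2 p * \<eta> 2 p = 0"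
    and \<phi>0: "\<And>p. p \<in> D \<Longrightarrow> ((\<lambda>p. \<phi> p $ 0) has_derivative
        (\<lambda>w. \<xi> 0 p * fst w + \<eta> 0 p * snd w)) (at p)"
    and \<phi>1: "\<And>p. p \<in> D \<Longrightarrow> ((\<lambda>p. \<phi> p $ 1) has_derivative
        (\<lambda>w. exp (\<mu>\<^sub>1 * \<phi> p $ 0) * \<xi> 1 p * fst w + exp (\<mu>\<^sub>1 * \<phi> p $ 0) * \<eta> 1 p * snd w)) (at p)"
    and \<phi>2: "\<And>p. p \<in> D \<Longrightarrow> ((\<lambda>p. \<phi> p $ 2) has_derivative
        (\<lambda>w. exp (\<mu>\<^sub>2 * \<phi> p $ 0) * \<xi> 2 p * fst w + exp (\<mu>\<^sub>2 * \<phi> p $ 0) * \<eta> 2 p * snd w)) (at p)"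
begin

lemma has_derivative_\<phi>:
  assumes "p \<in> D"
  shows "(\<phi> has_derivative (\<lambda>w. vec3 (\<xi> 0 p * fst w + \<eta> 0 p * snd w)
      (exp (\<mu>\<^sub>1 * \<phi> p $ 0) * (\<xi> 1 p * fst w + \<eta> 1 p * snd w))
      (exp (\<mu>\<^sub>2 * \<phi> p $ 0) * (\<xi> 2 p * fst w + \<eta> 2 p * snd w)))) (at p)"
  using has_derivative_vec3[OF \<phi>0[OF assms] \<phi>1[OF assms] \<phi>2[OF assms]]
  by (simp add: vec3_eta algebra_simps)

lemma dir_deriv_\<phi>:
  assumes "p \<in> D"
  shows "dir_deriv w \<phi> p = vec3 (\<xi> 0 p * fst w + \<eta> 0 p * snd w)
      (exp (\<mu>\<^sub>1 * \<phi> p $ 0) * (\<xi> 1 p * fst w + \<eta> 1 p * snd w))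
      (exp (\<mu>\<^sub>2 * \<phi> p $ 0) * (\<xi> 2 p * fst w + \<eta> 2 p * snd w))"
  by (rule dir_deriv_eq[OF has_derivative_\<phi>[OF assms]])

lemma smooth_\<phi>0: "smooth_on D (\<lambda>p. \<phi> p $ 0)"
  by (rule smooth_on_gradient[OF open_D \<phi>0 smooth_\<xi> smooth_\<eta>])

lemma smooth_\<phi>: "smooth_on D \<phi>"
proof -
  have s: "smooth_on D (\<lambda>p. exp (m * \<phi> p $ 0) * \<xi> i p)" "smooth_on D (\<lambda>p. exp (m * \<phi> p $ 0) * \<eta> i p)"
    for m i by (intro smooth_on_mult smooth_on_exp open_D smooth_\<phi>0 smooth_\<xi> smooth_\<eta>)+
  from smooth_on_vec3[OF open_D smooth_\<phi>0 smooth_on_gradient[OF open_D \<phi>1 s]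
      smooth_on_gradient[OF open_D \<phi>2 s]] show ?thesis by (simp add: vec3_eta)
qed

text \<open>The coefficient of \<open>du \<otimes> dv\<close> in the nondegeneracy condition, which is \<open>\<langle>\<phi>\<^sub>u, \<phi>\<^sub>v\<rangle>\<close>.\<close>
definition metric_factor :: "real \<times> real \<Rightarrow> real"
  where "metric_factor p = - (\<xi> 0 p * \<eta> 0 p) + \<xi> 1 p * \<eta> 1 p + \<xi> 2 p * \<eta> 2 p"

text \<open>The \<open>du \<otimes> du\<close> and \<open>dv \<otimes> dv\<close> terms vanish by the null conditions.\<close>
lemma induced_metric_\<phi>:
  assumes p: "p \<in> D"
  shows "induced_metric \<mu>\<^sub>1 \<mu>\<^sub>2 \<phi> p a b = metric_factor p * (fst a * snd b + snd a * fst b)"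
proof -
  have "induced_metric \<mu>\<^sub>1 \<mu>\<^sub>2 \<phi> p a b =
      (- (\<xi> 0 p * \<xi> 0 p) + \<xi> 1 p * \<xi> 1 p + \<xi> 2 p * \<xi> 2 p) * (fst a * fst b)
    + (- (\<eta> 0 p * \<eta> 0 p) + \<eta> 1 p * \<eta> 1 p + \<eta> 2 p * \<eta> 2 p) * (snd a * snd b)
    + metric_factor p * (fst a * snd b + snd a * fst b)"
    unfolding induced_metric_def dir_deriv_\<phi>[OF p] G_metric_frame metric_factor_def
    by (simp add: algebra_simps)
  then show ?thesis using null[OF p] by simp
qed

lemma weakly_conformal_\<phi>: "weakly_conformal \<mu>\<^sub>1 \<mu>\<^sub>2 D \<phi>"
  using induced_metric_\<phi> by (auto simp: weakly_conformal_def induced_metric_def)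

text \<open>A vector in the kernel of the differential is orthogonal to both null coordinate vectors and so is zero.\<close>
lemma timelike_surface_\<phi>:
  assumes nz: "\<And>p. p \<in> D \<Longrightarrow> metric_factor p \<noteq> 0"
  shows "timelike_surface \<mu>\<^sub>1 \<mu>\<^sub>2 D \<phi>"
  unfolding timelike_surface_def
proof (intro conjI ballI smooth_\<phi>)
  fix p assume p: "p \<in> D"
  have lin: "linear (frechet_derivative \<phi> (at p))"
    using smooth_on_differentiable[OF open_D smooth_\<phi> p] by (rule linear_frechet_derivative)
  have "w = 0" if "dir_deriv w \<phi> p = 0" for w
  proof -
    have "induced_metric \<mu>\<^sub>1 \<mu>\<^sub>2 \<phi> p w b = 0" for b
      using that by (simp add: induced_metric_def G_metric_def)
    from this[of "(1, 0)"] this[of "(0, 1)"] show "w = 0"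
      using nz[OF p] by (simp add: induced_metric_\<phi>[OF p] prod_eq_iff)
  qed
  then show "inj (frechet_derivative \<phi> (at p))"
    using linear_injective_0[OF lin] by blast
  \<comment> \<open>On \<open>(1, y)\<close> the induced metric takes the value \<open>2 metric_factor y\<close>.\<close>
  let ?r = "1 / (2 * metric_factor p)"
  show "lorentzian_form (induced_metric \<mu>\<^sub>1 \<mu>\<^sub>2 \<phi> p)"
    unfolding lorentzian_form_def induced_metric_\<phi>[OF p]
    by (rule exI[of _ "(1, - ?r)"], rule exI[of _ "(1, ?r)"]) (use nz[OF p] in auto)
qed

text \<open>Each order of differentiation uses one half of the structure equations: \<open>\<xi>_v\<close> for \<open>\<phi>\<^sub>u\<^sub>v\<close> and \<open>\<eta>_u\<close> for \<open>\<phi>\<^sub>v\<^sub>u\<close>.\<close>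
lemma mixed_second_derivatives:
  assumes p: "p \<in> D"
  shows "dir_deriv (0, 1) (dir_deriv (1, 0) \<phi>) p = vec3
      (\<mu>\<^sub>1 * (\<xi> 1 p * \<eta> 1 p) + \<mu>\<^sub>2 * (\<xi> 2 p * \<eta> 2 p))
      (exp (\<mu>\<^sub>1 * \<phi> p $ 0) * (\<mu>\<^sub>1 * (\<xi> 0 p * \<eta> 1 p + \<xi> 1 p * \<eta> 0 p)))
      (exp (\<mu>\<^sub>2 * \<phi> p $ 0) * (\<mu>\<^sub>2 * (\<xi> 0 p * \<eta> 2 p + \<xi> 2 p * \<eta> 0 p)))" (is "?A = ?V")
    and "dir_deriv (1, 0) (dir_deriv (0, 1) \<phi>) p = vec3
      (\<mu>\<^sub>1 * (\<xi> 1 p * \<eta> 1 p) + \<mu>\<^sub>2 * (\<xi> 2 p * \<eta> 2 p))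
      (exp (\<mu>\<^sub>1 * \<phi> p $ 0) * (\<mu>\<^sub>1 * (\<xi> 0 p * \<eta> 1 p + \<xi> 1 p * \<eta> 0 p)))
      (exp (\<mu>\<^sub>2 * \<phi> p $ 0) * (\<mu>\<^sub>2 * (\<xi> 0 p * \<eta> 2 p + \<xi> 2 p * \<eta> 0 p)))" (is "?B = ?V")
proof -
  note d = smooth_on_differentiable[OF open_D smooth_\<phi>0 p]
    smooth_on_differentiable[OF open_D smooth_\<xi> p] smooth_on_differentiable[OF open_D smooth_\<eta> p]
  have V: "dir_deriv e (\<lambda>q. vec3 (\<zeta> 0 q) (exp (\<mu>\<^sub>1 * \<phi> q $ 0) * \<zeta> 1 q) (exp (\<mu>\<^sub>2 * \<phi> q $ 0) * \<zeta> 2 q)) p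
    = vec3 (dir_deriv e (\<zeta> 0) p)
       (exp (\<mu>\<^sub>1 * \<phi> p $ 0) * (dir_deriv e (\<zeta> 1) p + \<mu>\<^sub>1 * (\<xi> 0 p * fst e + \<eta> 0 p * snd e) * \<zeta> 1 p))
       (exp (\<mu>\<^sub>2 * \<phi> p $ 0) * (dir_deriv e (\<zeta> 2) p + \<mu>\<^sub>2 * (\<xi> 0 p * fst e + \<eta> 0 p * snd e) * \<zeta> 2 p))"
    if "\<And>i. \<zeta> i differentiable at p" for \<zeta> :: "3 \<Rightarrow> real \<times> real \<Rightarrow> real" and e
  proof -
    have c: "dir_deriv e (\<lambda>q. exp (m * \<phi> q $ 0) * \<zeta> i q) p = exp (m * \<phi> p $ 0) *
        (dir_deriv e (\<zeta> i) p + m * (\<xi> 0 p * fst e + \<eta> 0 p * snd e) * \<zeta> i p)"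
      and m: "(\<lambda>q. exp (m * \<phi> q $ 0) * \<zeta> i q) differentiable at p" for m i
      using that d dir_deriv_exp[OF d(1), where c = m]
      by (simp_all add: dir_deriv_mult dir_deriv_eq[OF \<phi>0[OF p]] algebra_simps)
    note h = that[of 0] m[of \<mu>\<^sub>1 1] m[of \<mu>\<^sub>2 2]
    show ?thesis unfolding c[symmetric]
      by (rule dir_deriv_eq[OF has_derivative_vec3]) (use h in \<open>simp_all add: frechet_derivative_works\<close>)
  qed
  have "?A = dir_deriv (0, 1)
      (\<lambda>q. vec3 (\<xi> 0 q) (exp (\<mu>\<^sub>1 * \<phi> q $ 0) * \<xi> 1 q) (exp (\<mu>\<^sub>2 * \<phi> q $ 0) * \<xi> 2 q)) p"
    by (rule dir_deriv_cong[OF open_D _ p]) (simp add: dir_deriv_\<phi>)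
  also note V[of \<xi> "(0, 1)", OF d(2)]
  finally show "?A = ?V"
    by (simp add: \<xi>_v[OF p] algebra_simps)
  have "?B = dir_deriv (1, 0)
      (\<lambda>q. vec3 (\<eta> 0 q) (exp (\<mu>\<^sub>1 * \<phi> q $ 0) * \<eta> 1 q) (exp (\<mu>\<^sub>2 * \<phi> q $ 0) * \<eta> 2 q)) p"
    by (rule dir_deriv_cong[OF open_D _ p]) (simp add: dir_deriv_\<phi>)
  also note V[of \<eta> "(1, 0)", OF d(3)]
  finally show "?B = ?V"
    by (simp add: \<eta>_u[OF p] algebra_simps)
qed

text \<open>The equation of a harmonic map in null coordinates: the connection terms cancel the second derivatives.\<close>
lemma cov_deriv_mixed:
  assumes p: "p \<in> D"
  shows "cov_deriv \<mu>\<^sub>1 \<mu>\<^sub>2 \<phi> p 1 2 = 0" "cov_deriv \<mu>\<^sub>1 \<mu>\<^sub>2 \<phi> p 2 1 = 0"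
proof -
  have e': "m * exp (- (2 * m * r)) * (exp (m * r) * a * (exp (m * r) * b)) = m * (a * b)"
    for m r a b :: real using exp_frame[of m r a b] by (simp only: mult.assoc)
  show "cov_deriv \<mu>\<^sub>1 \<mu>\<^sub>2 \<phi> p 1 2 = 0" "cov_deriv \<mu>\<^sub>1 \<mu>\<^sub>2 \<phi> p 2 1 = 0"
    unfolding vec_eq_iff all_3_from_0 cov_deriv_def vec_lambda_beta christoffel_contract
    by (simp_all add: coord_vec_def mixed_second_derivatives[OF p] dir_deriv_\<phi>[OF p] e')
      (simp_all add: algebra_simps)
qed

lemma minimal_timelike_surface_\<phi>:
  assumes nz: "\<And>p. p \<in> D \<Longrightarrow> metric_factor p \<noteq> 0"
  shows "minimal_timelike_surface \<mu>\<^sub>1 \<mu>\<^sub>2 D \<phi>"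
proof -
  have "mean_curvature_vector \<mu>\<^sub>1 \<mu>\<^sub>2 \<phi> p = 0" if p: "p \<in> D" for p
  proof -
    have "first_fundamental_form \<mu>\<^sub>1 \<mu>\<^sub>2 \<phi> p $ a $ b = (if a = b then 0 else metric_factor p)" for a b
      by (auto simp: first_fundamental_form_def induced_metric_\<phi>[OF p] coord_vec_def)
        (metis (full_types) exhaust_2)+
    then have "matrix_inv (first_fundamental_form \<mu>\<^sub>1 \<mu>\<^sub>2 \<phi> p) $ 1 $ 1 = 0"
      "matrix_inv (first_fundamental_form \<mu>\<^sub>1 \<mu>\<^sub>2 \<phi> p) $ 2 $ 2 = 0"
      using matrix_inv_antidiagonal[of "first_fundamental_form \<mu>\<^sub>1 \<mu>\<^sub>2 \<phi> p" "metric_factor p"] nz[OF p] by simp_all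
    moreover have "normal_part \<mu>\<^sub>1 \<mu>\<^sub>2 \<phi> p 0 = 0"
      by (simp add: normal_part_def G_metric_def)
    ultimately show ?thesis
      by (simp add: mean_curvature_vector_def sum_2 second_fundamental_form_def cov_deriv_mixed[OF p])
  qed
  then show ?thesis
    using timelike_surface_\<phi>[OF nz] by (simp add: minimal_timelike_surface_def)
qed

lemma differential_\<phi>:
  assumes "p \<in> D"
  shows "dir_deriv e (\<lambda>p. \<phi> p $ 0) p = \<xi> 0 p * fst e + \<eta> 0 p * snd e"
    "dir_deriv e (\<lambda>p. \<phi> p $ 1) p = exp (\<mu>\<^sub>1 * \<phi> p $ 0) * (\<xi> 1 p * fst e + \<eta> 1 p * snd e)"
    "dir_deriv e (\<lambda>p. \<phi> p $ 2) p = exp (\<mu>\<^sub>2 * \<phi> p $ 0) * (\<xi> 2 p * fst e + \<eta> 2 p * snd e)"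
  using dir_deriv_eq[OF \<phi>0[OF assms]] dir_deriv_eq[OF \<phi>1[OF assms]] dir_deriv_eq[OF \<phi>2[OF assms]]
  by (simp_all add: algebra_simps)

lemma smooth_\<phi>_nth: "smooth_on D (\<lambda>p. \<phi> p $ i)"
  by (rule smooth_on_bounded_linear[OF bounded_linear_vec_nth open_D smooth_\<phi>])

text \<open>The right-hand side is the part of \<open>\<langle>\<Phi>\<^sub>u, \<Phi>\<^sub>v\<rangle>\<close> linear in \<open>W = \<Phi> - \<phi>\<close>. On the left stand the fields
  \<open>\<langle>W, \<phi>\<^sub>v\<rangle>\<close> and \<open>\<langle>W, \<phi>\<^sub>u\<rangle>\<close>. In their divergence the terms that contain \<open>W\<close> undifferentiated are
  evaluated by the structure equations: those with \<open>W\<^sub>1\<close> and \<open>W\<^sub>2\<close> cancel, and those with \<open>W\<^sub>0\<close> give the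
  derivative of the metric in the direction of \<open>W\<close>.\<close>
lemma linear_variation_divergence:
  assumes W: "\<And>i. smooth_on D (W i)" and p: "p \<in> D"
  shows "dir_deriv (1, 0) (\<lambda>p. - (\<eta> 0 p * W 0 p)
        + exp (- \<mu>\<^sub>1 * \<phi> p $ 0) * (\<eta> 1 p * W 1 p) + exp (- \<mu>\<^sub>2 * \<phi> p $ 0) * (\<eta> 2 p * W 2 p)) p
    + dir_deriv (0, 1) (\<lambda>p. - (\<xi> 0 p * W 0 p)
        + exp (- \<mu>\<^sub>1 * \<phi> p $ 0) * (\<xi> 1 p * W 1 p) + exp (- \<mu>\<^sub>2 * \<phi> p $ 0) * (\<xi> 2 p * W 2 p)) p
    = - (\<eta> 0 p * dir_deriv (1, 0) (W (0::3)) p) - \<xi> 0 p * dir_deriv (0, 1) (W 0) p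
      + (exp (- \<mu>\<^sub>1 * \<phi> p $ 0) * (\<eta> 1 p * dir_deriv (1, 0) (W 1) p + \<xi> 1 p * dir_deriv (0, 1) (W 1) p)
          - 2 * \<mu>\<^sub>1 * (W 0 p * (\<xi> 1 p * \<eta> 1 p)))
      + (exp (- \<mu>\<^sub>2 * \<phi> p $ 0) * (\<eta> 2 p * dir_deriv (1, 0) (W 2) p + \<xi> 2 p * dir_deriv (0, 1) (W 2) p)
          - 2 * \<mu>\<^sub>2 * (W 0 p * (\<xi> 2 p * \<eta> 2 p)))"
proof -
  note d = smooth_on_differentiable[OF open_D _ p]
  note dW = d[OF W] and d\<xi> = d[OF smooth_\<xi>] and d\<eta> = d[OF smooth_\<eta>]
  have t: "dir_deriv e (\<lambda>p. exp (- m * \<phi> p $ 0) * (\<zeta> p * w p)) p = exp (- m * \<phi> p $ 0) *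
      (dir_deriv e \<zeta> p * w p + \<zeta> p * dir_deriv e w p
        - m * (\<xi> 0 p * fst e + \<eta> 0 p * snd e) * (\<zeta> p * w p))"
    "(\<lambda>p. exp (- m * \<phi> p $ 0) * (\<zeta> p * w p)) differentiable at p"
    if "\<zeta> differentiable at p" "w differentiable at p" for e m \<zeta> w
  proof -
    note ex = dir_deriv_exp[OF d[OF smooth_\<phi>0], where c = "- m", unfolded differential_\<phi>[OF p]]
    have "(\<lambda>p. \<zeta> p * w p) differentiable at p" using that by simp
    then show "(\<lambda>p. exp (- m * \<phi> p $ 0) * (\<zeta> p * w p)) differentiable at p"
      and "dir_deriv e (\<lambda>p. exp (- m * \<phi> p $ 0) * (\<zeta> p * w p)) p = exp (- m * \<phi> p $ 0) *
        (dir_deriv e \<zeta> p * w p + \<zeta> p * dir_deriv e w p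
          - m * (\<xi> 0 p * fst e + \<eta> 0 p * snd e) * (\<zeta> p * w p))"
      using ex(2) that by (simp_all only: differentiable_mult dir_deriv_mult ex(1))
        (simp add: algebra_simps)
  qed
  have s: "dir_deriv e (\<lambda>p. - (\<zeta> 0 p * W 0 p) + exp (- \<mu>\<^sub>1 * \<phi> p $ 0) * (\<zeta> 1 p * W 1 p)
        + exp (- \<mu>\<^sub>2 * \<phi> p $ 0) * (\<zeta> 2 p * W 2 p)) p
    = - (dir_deriv e (\<zeta> 0) p * W 0 p + \<zeta> 0 p * dir_deriv e (W 0) p)
      + exp (- \<mu>\<^sub>1 * \<phi> p $ 0) * (dir_deriv e (\<zeta> 1) p * W 1 p + \<zeta> 1 p * dir_deriv e (W 1) p
        - \<mu>\<^sub>1 * (\<xi> 0 p * fst e + \<eta> 0 p * snd e) * (\<zeta> 1 p * W 1 p))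
      + exp (- \<mu>\<^sub>2 * \<phi> p $ 0) * (dir_deriv e (\<zeta> 2) p * W 2 p + \<zeta> 2 p * dir_deriv e (W 2) p
        - \<mu>\<^sub>2 * (\<xi> 0 p * fst e + \<eta> 0 p * snd e) * (\<zeta> 2 p * W 2 p))"
    if \<zeta>: "\<And>i. \<zeta> i differentiable at p" for \<zeta> :: "3 \<Rightarrow> real \<times> real \<Rightarrow> real" and e
  proof -
    have "dir_deriv e (\<lambda>p. - (\<zeta> 0 p * W 0 p)) p = - dir_deriv e (\<lambda>p. \<zeta> 0 p * W 0 p) p"
      by (rule dir_deriv_bounded_linear[OF bounded_linear_minus[OF bounded_linear_ident]])
        (simp add: \<zeta> dW)
    then have 0: "dir_deriv e (\<lambda>p. - (\<zeta> 0 p * W 0 p)) p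
        = - (dir_deriv e (\<zeta> 0) p * W 0 p + \<zeta> 0 p * dir_deriv e (W 0) p)"
      by (simp add: dir_deriv_mult \<zeta> dW)
    have 1: "(\<lambda>p. - (\<zeta> 0 p * W 0 p)) differentiable at p" by (simp add: \<zeta> dW)
    show ?thesis
      unfolding t(1)[OF \<zeta> dW, symmetric] 0[symmetric]
      by (simp only: dir_deriv_add differentiable_add 1 t(2)[OF \<zeta> dW])
  qed
  show ?thesis
    unfolding s[of \<eta> "(1, 0)", OF d\<eta>] s[of \<xi> "(0, 1)", OF d\<xi>] \<xi>_v[OF p] \<eta>_u[OF p]
    by (simp add: algebra_simps)
qed

text \<open>At each parameter value \<open>s\<close> the energy is a constant plus twice the integral of the remainder \<open>R\<close>, whose \<open>s\<close>-derivative
  vanishes at \<open>s = 0\<close>.\<close>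
lemma harmonic_map_\<phi>: "harmonic_map \<mu>\<^sub>1 \<mu>\<^sub>2 D \<phi>"
  unfolding harmonic_map_def
proof (intro conjI smooth_\<phi> allI impI, elim conjE)
  fix K \<epsilon> and \<Phi> :: "real \<times> (real \<times> real) \<Rightarrow> real^3"
  assume K: "compact K" "K \<subseteq> D" and \<epsilon>: "0 < \<epsilon>"
    and \<Phi>: "smooth_on ({-\<epsilon><..<\<epsilon>} \<times> D) \<Phi>"
    and init: "\<forall>p\<in>D. \<Phi> (0, p) = \<phi> p"
    and fix_out: "\<forall>s\<in>{-\<epsilon><..<\<epsilon>}. \<forall>p\<in>D - K. \<Phi> (s, p) = \<phi> p"
  define I where "I = {-\<epsilon><..<\<epsilon>}"
  have I: "open I" "0 \<in> I" using \<epsilon> by (auto simp: I_def)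
  note \<Phi> = \<Phi>[folded I_def] and fix_out = fix_out[folded I_def]
  have oID: "open (I \<times> D)" by (intro open_Times I open_D)
  have oDK: "open (D - K)" using open_D K(1) by (intro open_Diff compact_imp_closed)
  let ?T = uv_of_tx and ?K = "uv_of_tx -` K"
  have cK: "compact ?K" by (rule compact_uv_vimage[OF K(1)])

  \<comment> \<open>Points of the product are \<open>z = (s, p)\<close>; \<open>U\<close> and \<open>V\<close> are the null derivatives of the components \<open>X\<close> of \<open>\<Phi>\<close>.\<close>
  define X where "X = (\<lambda>i z. \<Phi> z $ i)"
  define U where "U = (\<lambda>i. dir_deriv (0, (1, 0)) (X i))"
  define V where "V = (\<lambda>i. dir_deriv (0, (0, 1)) (X i))"
  have X: "smooth_on (I \<times> D) (X i)" for i
    unfolding X_def by (rule smooth_on_bounded_linear[OF bounded_linear_vec_nth oID \<Phi>])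
  have U: "smooth_on (I \<times> D) (U i)" and V: "smooth_on (I \<times> D) (V i)" for i
    unfolding U_def V_def by (intro smooth_on_dir_deriv X)+
  have dX: "X i differentiable at (s, p)" if "s \<in> I" "p \<in> D" for i s p
    using smooth_on_differentiable[OF oID X] that by blast
  have UV_slice: "dir_deriv (1, 0) (\<lambda>p. X i (s, p)) p = U i (s, p)"
    "dir_deriv (0, 1) (\<lambda>p. X i (s, p)) p = V i (s, p)" if "s \<in> I" "p \<in> D" for i s p
    using dX[OF that] by (simp_all add: U_def V_def dir_deriv_slice)
  have at0: "X i (0, p) = \<phi> p $ i" "U i (0, p) = dir_deriv (1, 0) (\<lambda>p. \<phi> p $ i) p"
    "V i (0, p) = dir_deriv (0, 1) (\<lambda>p. \<phi> p $ i) p" if "p \<in> D" for i p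
    unfolding UV_slice[OF I(2) that, symmetric]
    using init that by (auto simp: X_def intro!: dir_deriv_cong[OF open_D])
  have out: "X i (s, p) = \<phi> p $ i" "U i (s, p) = dir_deriv (1, 0) (\<lambda>p. \<phi> p $ i) p"
    "V i (s, p) = dir_deriv (0, 1) (\<lambda>p. \<phi> p $ i) p" if "s \<in> I" "p \<in> D - K" for i s p
  proof -
    have "p \<in> D" using that by blast
    show "X i (s, p) = \<phi> p $ i" "U i (s, p) = dir_deriv (1, 0) (\<lambda>p. \<phi> p $ i) p"
      "V i (s, p) = dir_deriv (0, 1) (\<lambda>p. \<phi> p $ i) p"
      unfolding UV_slice[OF that(1) \<open>p \<in> D\<close>, symmetric]
      using fix_out that by (auto simp: X_def intro!: dir_deriv_cong[OF oDK])
  qed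

  \<comment> \<open>\<open>E\<close> is \<open>\<langle>\<Phi>\<^sub>u, \<Phi>\<^sub>v\<rangle>\<close> and \<open>L\<close> its part linear in \<open>\<Phi> - \<phi>\<close>; \<open>e0\<close>, \<open>l0\<close> and \<open>e m i\<close>, \<open>l m i\<close>
    are the contributions of the index \<open>0\<close> and of the index \<open>i\<close> with weight \<open>m\<close>.\<close>
  define e where "e = (\<lambda>m i z. exp ((- 2 * m) * X 0 z) * (U i z * V i z))"
  define l where "l = (\<lambda>m i z. exp (- m * \<phi> (snd z) $ 0) *
      (\<eta> i (snd z) * (U i z - exp (m * \<phi> (snd z) $ 0) * \<xi> i (snd z))
     + \<xi> i (snd z) * (V i z - exp (m * \<phi> (snd z) $ 0) * \<eta> i (snd z)))
     - 2 * m * ((X 0 z - \<phi> (snd z) $ 0) * (\<xi> i (snd z) * \<eta> i (snd z))))"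
  define e0 where "e0 = (\<lambda>z. - (U 0 z * V 0 z))"
  define l0 where "l0 = (\<lambda>z. - (\<eta> 0 (snd z) * (U 0 z - \<xi> 0 (snd z)))
     - \<xi> 0 (snd z) * (V 0 z - \<eta> 0 (snd z)))"
  define E where "E = (\<lambda>z. e0 z + e \<mu>\<^sub>1 1 z + e \<mu>\<^sub>2 2 z)"
  define L where "L = (\<lambda>z. l0 z + l \<mu>\<^sub>1 1 z + l \<mu>\<^sub>2 2 z)"
  define R where "R = (\<lambda>z. E z - metric_factor (snd z) - L z)"

  have s\<phi>: "smooth_on (I \<times> D) (\<lambda>z. \<phi> (snd z) $ 0)"
    by (rule smooth_on_snd[OF I(1) open_D smooth_\<phi>0])
  have s\<zeta>: "smooth_on (I \<times> D) (\<lambda>z. \<xi> i (snd z))" "smooth_on (I \<times> D) (\<lambda>z. \<eta> i (snd z))" for i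
    by (rule smooth_on_snd[OF I(1) open_D smooth_\<xi>], rule smooth_on_snd[OF I(1) open_D smooth_\<eta>])
  note sI = smooth_on_add smooth_on_diff smooth_on_mult smooth_on_minus smooth_on_exp
    smooth_on_const oID X U V s\<phi> s\<zeta>
  have sE: "smooth_on (I \<times> D) E" unfolding E_def e_def e0_def by (intro sI)
  have sL: "smooth_on (I \<times> D) L" unfolding L_def l_def l0_def by (intro sI)
  have sf: "smooth_on (I \<times> D) (\<lambda>z. metric_factor (snd z))" unfolding metric_factor_def by (intro sI)
  have sR: "smooth_on (I \<times> D) R" unfolding R_def by (intro smooth_on_diff oID sE sL sf)

  have R_out: "R (s, p) = 0" if "s \<in> I" "p \<in> D - K" for s p
  proof -
    have p: "p \<in> D" using that by blast
    show ?thesis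
      by (simp add: exp_frame R_def E_def L_def e_def l_def e0_def l0_def metric_factor_def out[OF that] differential_\<phi>[OF p])
  qed
  have R_crit: "((\<lambda>s. R (s, p)) has_real_derivative 0) (at 0)" if p: "p \<in> D" for p
  proof -
    have dX: "((\<lambda>s. X i (s, p)) has_real_derivative dir_deriv (1, 0) (X i) (0, p)) (at 0)"
      and dU: "((\<lambda>s. U i (s, p)) has_real_derivative dir_deriv (1, 0) (U i) (0, p)) (at 0)"
      and dV: "((\<lambda>s. V i (s, p)) has_real_derivative dir_deriv (1, 0) (V i) (0, p)) (at 0)" for i
      using I p by (auto intro!: has_real_derivative_slice smooth_on_differentiable[OF oID] X U V)
    have d0: "((\<lambda>s. e0 (s, p) - l0 (s, p)) has_real_derivative 0) (at 0)"
      unfolding e0_def l0_def snd_conv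
      by (rule derivative_eq_intros dU dV refl)+ (simp add: at0[OF p] differential_\<phi>[OF p] algebra_simps)
    have d: "((\<lambda>s. e m i (s, p) - l m i (s, p)) has_real_derivative 0) (at 0)"
      if u: "U i (0, p) = exp (m * \<phi> p $ 0) * \<xi> i p" and v: "V i (0, p) = exp (m * \<phi> p $ 0) * \<eta> i p"
      for m i
    proof -
      have sq: "exp (- (m * (2 * \<phi> p $ 0))) = exp (- (m * \<phi> p $ 0)) * exp (- (m * \<phi> p $ 0))"
        by (simp flip: exp_add)
      have cancel: "exp (m * \<phi> p $ 0) * (exp (- (m * \<phi> p $ 0)) * x) = x" for x
        by (simp flip: mult.assoc exp_add)
      show ?thesis unfolding e_def l_def snd_conv
        by (rule derivative_eq_intros dX dU dV refl)+
          (simp add: at0(1)[OF p] u v sq cancel algebra_simps)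
    qed
    have "((\<lambda>s. (e0 (s, p) - l0 (s, p)) + (e \<mu>\<^sub>1 1 (s, p) - l \<mu>\<^sub>1 1 (s, p))
        + (e \<mu>\<^sub>2 2 (s, p) - l \<mu>\<^sub>2 2 (s, p)) - metric_factor p) has_real_derivative 0 + 0 + 0 - 0) (at 0)"
      by (intro DERIV_add DERIV_diff DERIV_const d0 d) (simp_all add: at0[OF p] differential_\<phi>[OF p])
    then show ?thesis by (simp add: R_def E_def L_def algebra_simps)
  qed

  have L_int: "((\<lambda>q. L (s, ?T q)) has_integral 0) ?K" if s: "s \<in> I" for s
  proof -
    define W where "W = (\<lambda>i p. X i (s, p) - \<phi> p $ i)"
    have W: "smooth_on D (W i)" for i
      unfolding W_def
      by (intro smooth_on_diff open_D smooth_on_slice[OF I(1) open_D X s] smooth_\<phi>_nth)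
    have W_out: "W i p = 0" if "p \<in> D - K" for i p
      using out(1)[OF s that] by (simp add: W_def)
    have dW: "dir_deriv (1, 0) (W i) p = U i (s, p) - dir_deriv (1, 0) (\<lambda>p. \<phi> p $ i) p"
      "dir_deriv (0, 1) (W i) p = V i (s, p) - dir_deriv (0, 1) (\<lambda>p. \<phi> p $ i) p" if p: "p \<in> D" for i p
      unfolding W_def
      by (simp_all add: dir_deriv_diff UV_slice[OF s p]
          smooth_on_differentiable[OF open_D smooth_on_slice[OF I(1) open_D X s] p]
          smooth_on_differentiable[OF open_D smooth_\<phi>_nth p])
    define A where "A = (\<lambda>\<zeta> p. - (\<zeta> (0::3) p * W 0 p)
        + exp (- \<mu>\<^sub>1 * \<phi> p $ 0) * (\<zeta> 1 p * W 1 p) + exp (- \<mu>\<^sub>2 * \<phi> p $ 0) * (\<zeta> 2 p * W 2 p))"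
    have A: "smooth_on D (A \<xi>)" "smooth_on D (A \<eta>)"
      unfolding A_def
      by (intro smooth_on_add smooth_on_mult smooth_on_minus smooth_on_exp open_D W smooth_\<xi> smooth_\<eta> smooth_\<phi>0)+
    have zero: "((\<lambda>q. dir_deriv (1, 0) (A \<eta>) (?T q) + dir_deriv (0, 1) (A \<xi>) (?T q)) has_integral 0 + 0) ?K"
      by (intro has_integral_add integral_dir_deriv_zero[OF open_D K] A) (simp_all add: A_def W_out)
    have "dir_deriv (1, 0) (A \<eta>) p + dir_deriv (0, 1) (A \<xi>) p = L (s, p)" if p: "p \<in> D" for p
      unfolding A_def linear_variation_divergence[of W, OF W p] dW[OF p] differential_\<phi>[OF p]
      by (simp add: L_def l_def l0_def W_def)
    from this[OF subsetD[OF K(2)]]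
    have "dir_deriv (1, 0) (A \<eta>) (?T q) + dir_deriv (0, 1) (A \<xi>) (?T q) = L (s, ?T q)" if "q \<in> ?K" for q
      using that by blast
    from has_integral_eq[OF this zero] show ?thesis by simp
  qed

  \<comment> \<open>Polarization: \<open>\<Phi>\<^sub>t = \<Phi>\<^sub>u - \<Phi>\<^sub>v\<close> and \<open>\<Phi>\<^sub>x = \<Phi>\<^sub>u + \<Phi>\<^sub>v\<close>.\<close>
  have integrand: "1 / 2 * (- G_metric \<mu>\<^sub>1 \<mu>\<^sub>2 (\<Phi> (s, ?T q))
        (dir_deriv (1, 0) (\<lambda>q. \<Phi> (s, ?T q)) q) (dir_deriv (1, 0) (\<lambda>q. \<Phi> (s, ?T q)) q)
      + G_metric \<mu>\<^sub>1 \<mu>\<^sub>2 (\<Phi> (s, ?T q))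
        (dir_deriv (0, 1) (\<lambda>q. \<Phi> (s, ?T q)) q) (dir_deriv (0, 1) (\<lambda>q. \<Phi> (s, ?T q)) q))
      = 2 * E (s, ?T q)" if s: "s \<in> I" and q: "?T q \<in> D" for s q
  proof -
    have d: "\<Phi> differentiable at (s, ?T q)" using smooth_on_differentiable[OF oID \<Phi>] s q by blast
    have dq: "(\<lambda>q. \<Phi> (s, ?T q)) differentiable at q"
    proof -
      have "((\<lambda>q. (s, ?T q)) has_derivative (\<lambda>h. (0, ?T h))) (at q)"
        by (intro has_derivative_Pair has_derivative_const bounded_linear_imp_has_derivative bounded_linear_uv)
      from has_derivative_compose[OF this d[unfolded frechet_derivative_works]]
      show ?thesis by (rule differentiableI)
    qed
    have c: "dir_deriv w (\<lambda>q. \<Phi> (s, ?T q)) q $ i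
        = U i (s, ?T q) * fst (?T w) + V i (s, ?T q) * snd (?T w)" for w i
    proof -
      have dX': "(\<lambda>p. X i (s, p)) differentiable at (?T q)"
        by (rule smooth_on_differentiable[OF open_D smooth_on_slice[OF I(1) open_D X s] q])
      have "dir_deriv w (\<lambda>q. \<Phi> (s, ?T q)) q $ i = dir_deriv w (\<lambda>q. X i (s, ?T q)) q"
        unfolding X_def by (rule dir_deriv_bounded_linear[OF bounded_linear_vec_nth dq, symmetric])
      also have "\<dots> = dir_deriv (?T w) (\<lambda>p. X i (s, p)) (?T q)"
        using dir_deriv_affine(1)[OF bounded_linear_uv, of "\<lambda>p. X i (s, p)" 0 q w] dX' by simp
      also have "\<dots> = U i (s, ?T q) * fst (?T w) + V i (s, ?T q) * snd (?T w)"
        using dir_deriv_plane[OF dX', of "?T w"] by (simp only: UV_slice[OF s q])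
      finally show ?thesis .
    qed
    have "?T (1, 0) = (1, - 1)" "?T (0, 1) = (1, 1)" by (simp_all add: uv_of_tx_def)
    then show ?thesis
      by (simp only: G_metric_def c fst_conv snd_conv E_def e0_def e_def X_def[symmetric])
        (simp add: X_def algebra_simps)
  qed

  have cont: "continuous_on ?K (\<lambda>q. g (s, ?T q))" if "smooth_on (I \<times> D) g" "s \<in> I"
    for g :: "real \<times> (real \<times> real) \<Rightarrow> real" and s
    by (rule continuous_on_compose2[OF smooth_on_continuous[OF that(1)]])
      (use that(2) K(2) in \<open>auto intro!: continuous_intros continuous_on_uv\<close>)
  have en: "energy \<mu>\<^sub>1 \<mu>\<^sub>2 ?K (\<lambda>q. \<Phi> (s, ?T q))
      = 2 * integral ?K (\<lambda>q. R (s, ?T q)) + 2 * integral ?K (\<lambda>q. metric_factor (?T q))" if s: "s \<in> I" for s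
  proof -
    have "energy \<mu>\<^sub>1 \<mu>\<^sub>2 ?K (\<lambda>q. \<Phi> (s, ?T q)) = (LINT q:?K|lborel. 2 * E (s, ?T q))"
      unfolding energy_def
    proof (rule set_lebesgue_integral_cong)
      show "?K \<in> sets lborel" using borel_closed[OF compact_imp_closed[OF cK]] by simp
    qed (use integrand[OF s] K(2) in auto)
    also have "\<dots> = 2 * integral ?K (\<lambda>q. E (s, ?T q))"
      unfolding set_integral_compact(2)[OF cK continuous_on_mult_left[OF cont[OF sE s]]] by simp
    also have "(\<lambda>q. E (s, ?T q)) = (\<lambda>q. (R (s, ?T q) + metric_factor (?T q)) + L (s, ?T q))"
      by (simp add: R_def)
    also have "integral ?K \<dots> = integral ?K (\<lambda>q. R (s, ?T q)) + integral ?K (\<lambda>q. metric_factor (?T q))"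
      using set_integral_compact(1)[OF cK cont[OF sR s]] set_integral_compact(1)[OF cK cont[OF sf s]]
        L_int[OF s]
      by (simp add: integral_add integrable_add integral_unique has_integral_integrable)
    finally show ?thesis by simp
  qed
  have "((\<lambda>s. integral ?K (\<lambda>q. R (s, ?T q))) has_real_derivative 0) (at 0)"
    using R_out R_crit cK continuous_on_uv sR unfolding I_def
    by (intro derivative_of_integral_zero[OF open_D K \<epsilon>]) auto
  then have "((\<lambda>s. 2 * integral ?K (\<lambda>q. R (s, ?T q)) + 2 * integral ?K (\<lambda>q. metric_factor (?T q)))
      has_real_derivative 0) (at 0)"
    by (auto intro!: derivative_eq_intros)
  then show "((\<lambda>s. energy \<mu>\<^sub>1 \<mu>\<^sub>2 ?K (\<lambda>q. \<Phi> (s, ?T q))) has_real_derivative 0) (at 0)"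
    by (rule has_field_derivative_transform_within_open[OF _ I]) (simp add: en)
qed

end

section \<open>The integral representation\<close>

theorem mainTheorem3:
  fixes \<mu>\<^sub>1 \<mu>\<^sub>2 :: real
    and D :: "(real \<times> real) set"
    and \<xi> \<eta> :: "3 \<Rightarrow> real \<times> real \<Rightarrow> real"
    and \<omega>' \<omega>'' :: "3 \<Rightarrow> form1"
    and p\<^sub>0 :: "real \<times> real"
    and c :: "real^3"
  assumes "open D" and "connected D" and "simply_connected D"
    and "\<And>i. smooth_on D (\<xi> i)" and "\<And>i. smooth_on D (\<eta> i)"
    and "\<And>i. \<omega>' i = mult_form (\<xi> i) du" and "\<And>i. \<omega>'' i = mult_form (\<eta> i) dv"
    and "\<And>p a b. p \<in> D \<Longrightarrow> del2 (\<omega>' 0) p a b =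
          \<mu>\<^sub>1 * wedge (\<omega>'' 1) (\<omega>' 1) p a b + \<mu>\<^sub>2 * wedge (\<omega>'' 2) (\<omega>' 2) p a b"
    and "\<And>p a b. p \<in> D \<Longrightarrow> del2 (\<omega>' 1) p a b = \<mu>\<^sub>1 * wedge (\<omega>'' 1) (\<omega>' 0) p a b"
    and "\<And>p a b. p \<in> D \<Longrightarrow> del2 (\<omega>' 2) p a b = \<mu>\<^sub>2 * wedge (\<omega>'' 2) (\<omega>' 0) p a b"
    and "\<And>p a b. p \<in> D \<Longrightarrow> del1 (\<omega>'' 0) p a b =
          \<mu>\<^sub>1 * wedge (\<omega>' 1) (\<omega>'' 1) p a b + \<mu>\<^sub>2 * wedge (\<omega>' 2) (\<omega>'' 2) p a b"
    and "\<And>p a b. p \<in> D \<Longrightarrow> del1 (\<omega>'' 1) p a b = \<mu>\<^sub>1 * wedge (\<omega>' 1) (\<omega>'' 0) p a b"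
    and "\<And>p a b. p \<in> D \<Longrightarrow> del1 (\<omega>'' 2) p a b = \<mu>\<^sub>2 * wedge (\<omega>' 2) (\<omega>'' 0) p a b"
    and "\<And>p a b. p \<in> D \<Longrightarrow>
          - tensor (\<omega>' 0) (\<omega>' 0) p a b + tensor (\<omega>' 1) (\<omega>' 1) p a b
          + tensor (\<omega>' 2) (\<omega>' 2) p a b = 0"
    and "\<And>p a b. p \<in> D \<Longrightarrow>
          - tensor (\<omega>'' 0) (\<omega>'' 0) p a b + tensor (\<omega>'' 1) (\<omega>'' 1) p a b
          + tensor (\<omega>'' 2) (\<omega>'' 2) p a b = 0"
    and "p\<^sub>0 \<in> D"
  shows "(\<exists>\<phi>. integral_representation \<mu>\<^sub>1 \<mu>\<^sub>2 D p\<^sub>0 c \<omega>' \<omega>'' \<phi>) \<and>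
    (\<forall>\<phi>. integral_representation \<mu>\<^sub>1 \<mu>\<^sub>2 D p\<^sub>0 c \<omega>' \<omega>'' \<phi> \<longrightarrow>
       weakly_conformal \<mu>\<^sub>1 \<mu>\<^sub>2 D \<phi> \<and> harmonic_map \<mu>\<^sub>1 \<mu>\<^sub>2 D \<phi> \<and>
       ((\<forall>p\<in>D. \<exists>a b. - tensor (\<omega>' 0) (\<omega>'' 0) p a b + tensor (\<omega>' 1) (\<omega>'' 1) p a b
            + tensor (\<omega>' 2) (\<omega>'' 2) p a b \<noteq> 0) \<longrightarrow>
          minimal_timelike_surface \<mu>\<^sub>1 \<mu>\<^sub>2 D \<phi>))"
proof -
  note D = assms(1-3) and s\<xi> = assms(4) and s\<eta> = assms(5) and \<omega> = assms(6,7)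
    and E = assms(8-13) and N = assms(14,15) and p0 = assms(16)
  \<comment> \<open>Evaluating the equations between forms on coordinate vectors gives their coefficients.\<close>
  note uv = \<omega> wedge_def du_def dv_def mult_form_def tensor_def
  have \<omega>_apply: "\<omega>' i p w = \<xi> i p * fst w" "\<omega>'' i p w = \<eta> i p * snd w" for i p w
    by (simp_all add: uv)
  have \<xi>_v: "dir_deriv (0, 1) (\<xi> 0) p = \<mu>\<^sub>1 * (\<xi> 1 p * \<eta> 1 p) + \<mu>\<^sub>2 * (\<xi> 2 p * \<eta> 2 p)"
    "dir_deriv (0, 1) (\<xi> 1) p = \<mu>\<^sub>1 * (\<xi> 0 p * \<eta> 1 p)"
    "dir_deriv (0, 1) (\<xi> 2) p = \<mu>\<^sub>2 * (\<xi> 0 p * \<eta> 2 p)" if p: "p \<in> D" for p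
    using E(1-3)[OF p, of "(0, 1)" "(1, 0)"] unfolding \<omega>(1) del2_mult_du
    by (simp_all add: uv mult.commute)
  have \<eta>_u: "dir_deriv (1, 0) (\<eta> 0) p = \<mu>\<^sub>1 * (\<xi> 1 p * \<eta> 1 p) + \<mu>\<^sub>2 * (\<xi> 2 p * \<eta> 2 p)"
    "dir_deriv (1, 0) (\<eta> 1) p = \<mu>\<^sub>1 * (\<xi> 1 p * \<eta> 0 p)"
    "dir_deriv (1, 0) (\<eta> 2) p = \<mu>\<^sub>2 * (\<xi> 2 p * \<eta> 0 p)" if p: "p \<in> D" for p
    using E(4-6)[OF p, of "(1, 0)" "(0, 1)"] unfolding \<omega>(2) del1_mult_dv
    by (simp_all add: uv mult.commute)
  have null: "- (\<xi> 0 p * \<xi> 0 p) + \<xi> 1 p * \<xi> 1 p + \<xi> 2 p * \<xi> 2 p = 0"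
    "- (\<eta> 0 p * \<eta> 0 p) + \<eta> 1 p * \<eta> 1 p + \<eta> 2 p * \<eta> 2 p = 0" if p: "p \<in> D" for p
    using N(1)[OF p, of "(1, 0)" "(1, 0)"] N(2)[OF p, of "(0, 1)" "(0, 1)"]
    by (simp_all add: uv)

  have "\<exists>F. \<forall>p\<in>D. (F has_derivative (\<lambda>w. \<xi> 0 p * fst w + \<eta> 0 p * snd w)) (at p)"
    using \<xi>_v(1) \<eta>_u(1) by (intro smooth_closed_form_has_potential D s\<xi> s\<eta>) simp
  then obtain F where F: "\<And>p. p \<in> D \<Longrightarrow>
      (F has_derivative (\<lambda>w. \<xi> 0 p * fst w + \<eta> 0 p * snd w)) (at p)" by blast
  define x0 where "x0 = (\<lambda>p. F p - F p\<^sub>0 + c $ 0)"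
  have x0: "(x0 has_derivative (\<lambda>w. \<xi> 0 p * fst w + \<eta> 0 p * snd w)) (at p)" if "p \<in> D" for p
    unfolding x0_def by (auto intro!: derivative_eq_intros F that)
  have sx0: "smooth_on D x0"
    by (rule smooth_on_gradient[OF D(1) x0 s\<xi> s\<eta>])
  have pot: "\<exists>F. \<forall>p\<in>D. (F has_derivative
      (\<lambda>w. exp (m * x0 p) * \<xi> i p * fst w + exp (m * x0 p) * \<eta> i p * snd w)) (at p)"
    if \<xi>i: "\<And>p. p \<in> D \<Longrightarrow> dir_deriv (0, 1) (\<xi> i) p = m * (\<xi> 0 p * \<eta> i p)"
      and \<eta>i: "\<And>p. p \<in> D \<Longrightarrow> dir_deriv (1, 0) (\<eta> i) p = m * (\<xi> i p * \<eta> 0 p)" for m i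
  proof (rule smooth_closed_form_has_potential[OF D(1,3)])
    fix p assume p: "p \<in> D"
    note d = smooth_on_differentiable[OF D(1) _ p]
    note ex = dir_deriv_exp[OF d[OF sx0], where c = m, unfolded dir_deriv_eq[OF x0[OF p]]]
    show "dir_deriv (0, 1) (\<lambda>p. exp (m * x0 p) * \<xi> i p) p = dir_deriv (1, 0) (\<lambda>p. exp (m * x0 p) * \<eta> i p) p"
      by (simp add: dir_deriv_mult ex d[OF s\<xi>] d[OF s\<eta>] \<xi>i[OF p] \<eta>i[OF p] algebra_simps)
  qed (intro smooth_on_mult smooth_on_exp D sx0 s\<xi> s\<eta>)+
  obtain F1 where F1: "\<And>p. p \<in> D \<Longrightarrow> (F1 has_derivative
      (\<lambda>w. exp (\<mu>\<^sub>1 * x0 p) * \<xi> 1 p * fst w + exp (\<mu>\<^sub>1 * x0 p) * \<eta> 1 p * snd w)) (at p)"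
    using pot[OF \<xi>_v(2) \<eta>_u(2)] by blast
  obtain F2 where F2: "\<And>p. p \<in> D \<Longrightarrow> (F2 has_derivative
      (\<lambda>w. exp (\<mu>\<^sub>2 * x0 p) * \<xi> 2 p * fst w + exp (\<mu>\<^sub>2 * x0 p) * \<eta> 2 p * snd w)) (at p)"
    using pot[OF \<xi>_v(3) \<eta>_u(3)] by blast
  define x1 where "x1 = (\<lambda>p. F1 p - F1 p\<^sub>0 + c $ 1)"
  define x2 where "x2 = (\<lambda>p. F2 p - F2 p\<^sub>0 + c $ 2)"
  have x1: "(x1 has_derivative
      (\<lambda>w. exp (\<mu>\<^sub>1 * x0 p) * \<xi> 1 p * fst w + exp (\<mu>\<^sub>1 * x0 p) * \<eta> 1 p * snd w)) (at p)"
    and x2: "(x2 has_derivative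
      (\<lambda>w. exp (\<mu>\<^sub>2 * x0 p) * \<xi> 2 p * fst w + exp (\<mu>\<^sub>2 * x0 p) * \<eta> 2 p * snd w)) (at p)"
    if "p \<in> D" for p
    unfolding x1_def x2_def by (auto intro!: derivative_eq_intros F1 F2 that)
  have I0: "is_line_integral_of D p\<^sub>0 (c $ 0) (\<lambda>p w. \<omega>' 0 p w + \<omega>'' 0 p w) x0"
    unfolding x0_def by (rule is_line_integral_of_potential[OF F]) (simp_all add: \<omega>_apply)
  have I1: "is_line_integral_of D p\<^sub>0 (c $ 1)
      (\<lambda>p w. exp (\<mu>\<^sub>1 * x0 p) * \<omega>' 1 p w + exp (\<mu>\<^sub>1 * x0 p) * \<omega>'' 1 p w) x1"
    unfolding x1_def by (rule is_line_integral_of_potential[OF F1]) (simp_all add: \<omega>_apply)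
  have I2: "is_line_integral_of D p\<^sub>0 (c $ 2)
      (\<lambda>p w. exp (\<mu>\<^sub>2 * x0 p) * \<omega>' 2 p w + exp (\<mu>\<^sub>2 * x0 p) * \<omega>'' 2 p w) x2"
    unfolding x2_def by (rule is_line_integral_of_potential[OF F2]) (simp_all add: \<omega>_apply)

  show ?thesis
  proof (intro conjI allI impI)
    show "\<exists>\<phi>. integral_representation \<mu>\<^sub>1 \<mu>\<^sub>2 D p\<^sub>0 c \<omega>' \<omega>'' \<phi>"
      using I0 I1 I2
      by (intro exI[of _ "\<lambda>p. vec3 (x0 p) (x1 p) (x2 p)"]) (simp add: integral_representation_def)
  next
    fix \<phi> assume "integral_representation \<mu>\<^sub>1 \<mu>\<^sub>2 D p\<^sub>0 c \<omega>' \<omega>'' \<phi>"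
    note \<phi> = this[unfolded integral_representation_def]
    note u = is_line_integral_of_unique[OF D(1,2) p0]
    \<comment> \<open>The zeroth component is determined first; only then are the forms defining the other two known.\<close>
    have e0: "x0 p = \<phi> p $ 0" if "p \<in> D" for p
      using \<phi> by (intro u[OF that I0]) auto
    have e1: "x1 p = \<phi> p $ 1" if "p \<in> D" for p
      using \<phi> by (intro u[OF that I1]) (auto simp: e0)
    have e2: "x2 p = \<phi> p $ 2" if "p \<in> D" for p
      using \<phi> by (intro u[OF that I2]) (auto simp: e0)
    interpret integrated_data \<mu>\<^sub>1 \<mu>\<^sub>2 D \<xi> \<eta> \<phi>
    proof
      fix p assume p: "p \<in> D"
      note t = has_derivative_transform_within_open[OF _ D(1) p]
      show "((\<lambda>p. \<phi> p $ 0) has_derivative (\<lambda>w. \<xi> 0 p * fst w + \<eta> 0 p * snd w)) (at p)"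
        by (rule t[OF x0[OF p]]) (rule e0)
      show "((\<lambda>p. \<phi> p $ 1) has_derivative
        (\<lambda>w. exp (\<mu>\<^sub>1 * \<phi> p $ 0) * \<xi> 1 p * fst w + exp (\<mu>\<^sub>1 * \<phi> p $ 0) * \<eta> 1 p * snd w)) (at p)"
        by (rule t[OF x1[OF p, unfolded e0[OF p]]]) (rule e1)
      show "((\<lambda>p. \<phi> p $ 2) has_derivative
        (\<lambda>w. exp (\<mu>\<^sub>2 * \<phi> p $ 0) * \<xi> 2 p * fst w + exp (\<mu>\<^sub>2 * \<phi> p $ 0) * \<eta> 2 p * snd w)) (at p)"
        by (rule t[OF x2[OF p, unfolded e0[OF p]]]) (rule e2)
    qed (fact D(1) s\<xi> s\<eta> \<xi>_v \<eta>_u null)+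
    show "weakly_conformal \<mu>\<^sub>1 \<mu>\<^sub>2 D \<phi>" by (rule weakly_conformal_\<phi>)
    show "harmonic_map \<mu>\<^sub>1 \<mu>\<^sub>2 D \<phi>" by (rule harmonic_map_\<phi>)
    assume nz: "\<forall>p\<in>D. \<exists>a b. - tensor (\<omega>' 0) (\<omega>'' 0) p a b + tensor (\<omega>' 1) (\<omega>'' 1) p a b
        + tensor (\<omega>' 2) (\<omega>'' 2) p a b \<noteq> 0"
    have eq: "- tensor (\<omega>' 0) (\<omega>'' 0) p a b + tensor (\<omega>' 1) (\<omega>'' 1) p a b
        + tensor (\<omega>' 2) (\<omega>'' 2) p a b = metric_factor p * (fst a * snd b)" for p a b
      by (simp add: metric_factor_def tensor_def \<omega>_apply algebra_simps)
    have "metric_factor p \<noteq> 0" if "p \<in> D" for p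
      using nz[unfolded eq] that by force
    then show "minimal_timelike_surface \<mu>\<^sub>1 \<mu>\<^sub>2 D \<phi>" by (rule minimal_timelike_surface_\<phi>)
  qed
qed

end
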